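(* Let $M$ be a closed oriented Riemannian three-manifold with a finite triangulation $K$, and let $C^1(K)=V_{\mathrm p}\oplus V_{\mathrm g}$ be the orthogonal splitting with $V_{\mathrm p}=\mathcal H^1_K\oplus\operatorname{im}\delta_1^\ast$ and $V_{\mathrm g}=\operatorname{im}\delta_0$. Let $\theta\mapsto\mu_\theta$ be a smooth family of nondegenerate Gaussian measures on $V_{\mathrm p}\oplus V_{\mathrm g}$, with densities $f_\theta(x,y)=f_{\theta,\mathrm p}(x)\,f_{\theta,\mathrm g|x}(y)$, where $f_{\theta,\mathrm p}$ is the density of the marginal on $V_{\mathrm p}$ and $f_{\theta,\mathrm g|x}$ is the conditional density on $V_{\mathrm g}$ given $x$. Define $$g^{\mathrm{aux}}_{ij}(\theta)=\int \partial_i\log f_\theta\,\partial_j\log f_\theta\,f_\theta\,dx\,dy,\qquad g^{\mathrm{phys}}_{ij}(\theta)=\int\partial_i\log f_{\theta,\mathrm p}\,\partial_j\log f_{\theta,\mathrm p}\,f_{\theta,\mathrm p}\,dx.$$ Then $$g^{\mathrm{aux}}_{ij}(\theta)=g^{\mathrm{phys}}_{ij}(\theta)+g^{\mathrm{cond}}_{ij}(\theta),$$ where $$g^{\mathrm{cond}}_{ij}(\theta)=\int_{V_{\mathrm p}}\left[\int_{V_{\mathrm g}}\partial_i\log f_{\theta,\mathrm g|x}(y)\,\partial_j\log f_{\theta,\mathrm g|x}(y)\,f_{\theta,\mathrm g|x}(y)\,dy\right]f_{\theta,\mathrm p}(x)\,dx.$$ In particular, $g^{\mathrm{aux}}(\theta)-g^{\mathrm{phys}}(\theta)\ge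 0$ as a quadratic form.
   Context: $C^k(K)=C^k(K;\mathbb R)$ is the space of real simplicial $k$-cochains of $K$, $\delta_k:C^k(K)\to C^{k+1}(K)$ is the coboundary, and $W_k:C^k(K)\to\Omega^k_{\mathrm{pw}}(M)$ are the Whitney maps into piecewise smooth forms (the linear maps sending the cochain dual to an oriented simplex $[v_0,\dots,v_k]$ to $k!\sum_{i}(-1)^i\lambda_i\,d\lambda_0\wedge\cdots\wedge\widehat{d\lambda_i}\wedge\cdots\wedge d\lambda_k$, with $\lambda_i$ the barycentric coordinate function of $v_i$). Each $C^k(K)$ carries the Whitney inner product $\langle u,v\rangle_k=\int_M W_k(u)\wedge\star W_k(v)$, and $\delta_k^\ast$ denotes the adjoint of $\delta_k$ for these inner products. The harmonic space is $\mathcal H^1_K=\ker\delta_1\cap\ker\delta_0^\ast$, and one has the orthogonal discrete Hodge decomposition $C^1(K)=\operatorname{im}\delta_0\oplus\mathcal H^1_K\oplus\operatorname{im}\delta_1^\ast$. Elements of $C^1(K)$ are written in Whitney-orthonormal coordinates as $a=(x,y)$ with $x\in V_{\mathrm p}$, $y\in V_{\mathrm g}$, and densities are with respect to Lebesgue measure in these coordinates. Nondegenerate Gaussian means with positive definite covariance matrix. The parameter $\theta=(\theta_1,\dots,\theta_n)$ ranges over an open subset of some $\mathbb R^n$, $\partial_i=\partial/\partial\theta_i$, and a smooth family of Gaussian measures is one whose mean vector and covariance matrix depend smoothly on $\theta$. *)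

theory Defs
  imports "HOL-Analysis.Analysis" "HOL-Combinatorics.Permutations"
begin

section \<open>Smooth maps\<close>

(* Only used on open sets S, where frechet_derivative f (at x) is the derivative of f. *)
primrec Ck_on :: "nat \<Rightarrow> 'a::euclidean_space set \<Rightarrow> ('a \<Rightarrow> 'b::real_normed_vector) \<Rightarrow> bool" where
  "Ck_on 0 S f \<longleftrightarrow> continuous_on S f"
| "Ck_on (Suc k) S f \<longleftrightarrow>
     f differentiable_on S \<and> (\<forall>e\<in>Basis. Ck_on k S (\<lambda>x. frechet_derivative f (at x) e))"

definition smooth_on :: "'a::euclidean_space set \<Rightarrow> ('a \<Rightarrow> 'b::real_normed_vector) \<Rightarrow> bool" where
  "smooth_on S f \<longleftrightarrow> (\<forall>k. Ck_on k S f)"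

definition pos_def :: "real^'k^'k \<Rightarrow> bool" where
  "pos_def S \<longleftrightarrow> transpose S = S \<and> (\<forall>x. x \<noteq> 0 \<longrightarrow> 0 < x \<bullet> (S *v x))"


section \<open>Closed oriented Riemannian three-manifolds\<close>

type_synonym 'm chart = "'m set \<times> ('m \<Rightarrow> real^3)"

definition transition :: "'m chart \<Rightarrow> 'm chart \<Rightarrow> real^3 \<Rightarrow> real^3" where
  "transition c c' = snd c' \<circ> inv_into (fst c) (snd c)"

definition oriented_atlas :: "'m topology \<Rightarrow> 'm chart set \<Rightarrow> bool" where
  "oriented_atlas M A \<longleftrightarrow>
     (\<forall>(U, \<phi>)\<in>A. openin M U \<and> open (\<phi> ` U) \<and>
        homeomorphic_map (subtopology M U) (top_of_set (\<phi> ` U)) \<phi>) \<and>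
     (\<Union>c\<in>A. fst c) = topspace M \<and>
     (\<forall>c\<in>A. \<forall>c'\<in>A. smooth_on (snd c ` (fst c \<inter> fst c')) (transition c c') \<and>
        (\<forall>x \<in> snd c ` (fst c \<inter> fst c').
           0 < det (matrix (frechet_derivative (transition c c') (at x)))))"

(* G c x is the Gram matrix of the metric in the chart c at the coordinate point x. *)
definition riemannian_metric ::
    "'m chart set \<Rightarrow> ('m chart \<Rightarrow> real^3 \<Rightarrow> real^3^3) \<Rightarrow> bool" where
  "riemannian_metric A G \<longleftrightarrow>
     (\<forall>c\<in>A. smooth_on (snd c ` fst c) (G c) \<and> (\<forall>x \<in> snd c ` fst c. pos_def (G c x))) \<and>
     (\<forall>c\<in>A. \<forall>c'\<in>A. \<forall>x \<in> snd c ` (fst c \<inter> fst c').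
        let J = matrix (frechet_derivative (transition c c') (at x))
        in G c x = transpose J ** G c' (transition c c' x) ** J)"

(* Second countability follows from compactness. *)
definition closed_oriented_riemannian_3manifold ::
    "'m topology \<Rightarrow> 'm chart set \<Rightarrow> ('m chart \<Rightarrow> real^3 \<Rightarrow> real^3^3) \<Rightarrow> bool" where
  "closed_oriented_riemannian_3manifold M A G \<longleftrightarrow>
     compact_space M \<and> Hausdorff_space M \<and> oriented_atlas M A \<and> riemannian_metric A G"


section \<open>Smooth triangulations\<close>

(* A finite simplicial complex K in a Euclidean space with a homeomorphism h from its underlying
   polyhedron onto M whose restriction to every closed simplex is a smooth immersion. *)
definition smooth_triangulation ::
    "'m topology \<Rightarrow> 'm chart set \<Rightarrow> 'b::euclidean_space set set \<Rightarrow> ('b \<Rightarrow> 'm) \<Rightarrow> bool" where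
  "smooth_triangulation M A K h \<longleftrightarrow>
     simplicial_complex K \<and>
     homeomorphic_map (top_of_set (\<Union>K)) M h \<and>
     (\<forall>S\<in>K. \<forall>p\<in>S. \<forall>(U, \<phi>)\<in>A. h p \<in> U \<longrightarrow>
        (\<exists>N F. open N \<and> p \<in> N \<and> smooth_on N F \<and>
           (\<forall>q \<in> S \<inter> N. h q \<in> U \<and> F q = \<phi> (h q)) \<and>
           inj_on (frechet_derivative F (at p)) (span {x - y | x y. x \<in> S \<and> y \<in> S})))"


section \<open>Simplicial cochains\<close>

definition ordered_simplices :: "'b::euclidean_space set set \<Rightarrow> nat \<Rightarrow> 'b list set" where
  "ordered_simplices K k =
     {vs. length vs = Suc k \<and> distinct vs \<and> \<not> affine_dependent (set vs) \<and> convex hull (set vs) \<in> K}"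

(* Cochains are alternating functions of the ordered vertices; they are 0 off the k-simplices of K. *)
definition cochains :: "'b::euclidean_space set set \<Rightarrow> nat \<Rightarrow> ('b list \<Rightarrow> real) set" where
  "cochains K k =
     {u. (\<forall>vs. vs \<notin> ordered_simplices K k \<longrightarrow> u vs = 0) \<and>
         (\<forall>vs\<in>ordered_simplices K k. \<forall>p. p permutes {..k} \<longrightarrow>
            u (map (\<lambda>i. vs ! p i) [0..<Suc k]) = of_int (sign p) * u vs)}"

definition omit :: "nat \<Rightarrow> 'a list \<Rightarrow> 'a list" where
  "omit i xs = take i xs @ drop (Suc i) xs"

definition coboundary ::
    "'b::euclidean_space set set \<Rightarrow> nat \<Rightarrow> ('b list \<Rightarrow> real) \<Rightarrow> 'b list \<Rightarrow> real" where
  "coboundary K k u = (\<lambda>vs. if vs \<in> ordered_simplices K (Suc k)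
     then \<Sum>i\<le>Suc k. (-1) ^ i * u (omit i vs) else 0)"


section \<open>Exterior algebra of three-space\<close>

(* A k-form at a point is an alternating multilinear function of lists of k vectors. *)
type_synonym form3 = "(real^3) list \<Rightarrow> real"

definition wedge :: "nat \<Rightarrow> nat \<Rightarrow> form3 \<Rightarrow> form3 \<Rightarrow> form3" where
  "wedge k l \<alpha> \<beta> = (\<lambda>Xs.
     (\<Sum>p | p permutes {..<k + l}. of_int (sign p) *
        \<alpha> (map (\<lambda>i. Xs ! p i) [0..<k]) * \<beta> (map (\<lambda>i. Xs ! p i) [k..<k + l]))
     / (fact k * fact l))"

primrec wedge_list :: "form3 list \<Rightarrow> form3" where
  "wedge_list [] = (\<lambda>_. 1)"
| "wedge_list (\<alpha> # \<alpha>s) = wedge 1 (length \<alpha>s) \<alpha> (wedge_list \<alpha>s)"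

definition differential :: "(real^3 \<Rightarrow> real) \<Rightarrow> real^3 \<Rightarrow> form3" where
  "differential f t = (\<lambda>Xs. frechet_derivative f (at t) (hd Xs))"

definition volume_form :: "real^3^3 \<Rightarrow> form3" where
  "volume_form g = (\<lambda>Xs. sqrt (det g) *
     det (vector [Xs ! 0, Xs ! 1, Xs ! 2] :: real^3^3))"

(* Hodge star of a k-form for the Gram matrix g and the standard orientation: contraction of the
   volume form with the index-raised form, normalised so that
   wedge a (star b) = (inner product of a and b) * volume. *)
definition hodge_star :: "real^3^3 \<Rightarrow> nat \<Rightarrow> form3 \<Rightarrow> form3" where
  "hodge_star g k \<beta> = (\<lambda>Xs.
     (\<Sum>js | length js = k. \<beta> (map (\<lambda>j. axis j 1) js) *
        volume_form g (map (\<lambda>j. matrix_inv g *v axis j 1) js @ Xs)) / fact k)"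


section \<open>Whitney forms and the Whitney inner product\<close>

(* Forms on a closed tetrahedron with ordered vertices vs are written in its affine coordinates,
   that is, pulled back along tetra_param vs. *)
definition tetra_param :: "'b::euclidean_space list \<Rightarrow> real^3 \<Rightarrow> 'b" where
  "tetra_param vs t = vs ! 0 + (t$1) *\<^sub>R (vs ! 1 - vs ! 0)
     + (t$2) *\<^sub>R (vs ! 2 - vs ! 0) + (t$3) *\<^sub>R (vs ! 3 - vs ! 0)"

definition open_tetra :: "(real^3) set" where
  "open_tetra = {t. (\<forall>i. 0 < t$i) \<and> t$1 + t$2 + t$3 < 1}"

(* The coordinate of the vertex v, as an affine function on the affine hull of the vertex set C of a
   simplex; it is 0 if v is not in C. *)
definition barycentric :: "'b::euclidean_space set \<Rightarrow> 'b \<Rightarrow> 'b \<Rightarrow> real" where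
  "barycentric C v p = (THE u. (\<forall>w. w \<notin> C \<longrightarrow> u w = 0) \<and> sum u C = 1 \<and>
     (\<Sum>w\<in>C. u w *\<^sub>R w) = p) v"

definition bary_coord :: "'b::euclidean_space list \<Rightarrow> 'b \<Rightarrow> real^3 \<Rightarrow> real" where
  "bary_coord vs v t = barycentric (set vs) v (tetra_param vs t)"

definition whitney_form :: "'b::euclidean_space list \<Rightarrow> 'b list \<Rightarrow> real^3 \<Rightarrow> form3" where
  "whitney_form vs ws t = (\<lambda>Xs. let k = length ws - 1 in
     fact k * (\<Sum>i\<le>k. (-1) ^ i * bary_coord vs (ws ! i) t *
       wedge_list (map (\<lambda>w. differential (bary_coord vs w) t) (omit i ws)) Xs))"

(* The linear extension of: cochain dual to ws |-> whitney_form of ws. Both u ws and the form change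
   sign with the orientation of ws, so each k-simplex occurs (k+1)! times with the same term. *)
definition whitney_map ::
    "'b::euclidean_space set set \<Rightarrow> nat \<Rightarrow> ('b list \<Rightarrow> real) \<Rightarrow> 'b list \<Rightarrow> real^3 \<Rightarrow> form3" where
  "whitney_map K k u vs t = (\<lambda>Xs.
     (\<Sum>ws\<in>ordered_simplices K k. u ws * whitney_form vs ws t Xs) / fact (Suc k))"

definition tetra_jacobian ::
    "('b::euclidean_space \<Rightarrow> 'm) \<Rightarrow> 'm chart \<Rightarrow> 'b list \<Rightarrow> real^3 \<Rightarrow> real^3^3" where
  "tetra_jacobian h c vs t = matrix (frechet_derivative (snd c \<circ> h \<circ> tetra_param vs) (at t))"

(* The choice of the chart does not matter, by the transformation law of the metric. *)
definition tetra_metric ::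
    "'m chart set \<Rightarrow> ('m chart \<Rightarrow> real^3 \<Rightarrow> real^3^3) \<Rightarrow> ('b::euclidean_space \<Rightarrow> 'm) \<Rightarrow>
     'b list \<Rightarrow> real^3 \<Rightarrow> real^3^3" where
  "tetra_metric A G h vs t =
     (let c = (SOME c. c \<in> A \<and> h (tetra_param vs t) \<in> fst c);
          J = tetra_jacobian h c vs t
      in transpose J ** G c (snd c (h (tetra_param vs t))) ** J)"

definition positively_ordered ::
    "'m chart set \<Rightarrow> ('b::euclidean_space \<Rightarrow> 'm) \<Rightarrow> 'b list \<Rightarrow> bool" where
  "positively_ordered A h vs \<longleftrightarrow>
     (\<forall>t\<in>open_tetra. \<forall>c\<in>A. h (tetra_param vs t) \<in> fst c \<longrightarrow> 0 < det (tetra_jacobian h c vs t))"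

definition positive_ordering ::
    "'m chart set \<Rightarrow> 'b::euclidean_space set set \<Rightarrow> ('b \<Rightarrow> 'm) \<Rightarrow> 'b set \<Rightarrow> 'b list" where
  "positive_ordering A K h T = (SOME vs. vs \<in> ordered_simplices K 3 \<and>
     convex hull (set vs) = T \<and> positively_ordered A h vs)"

(* Integral over M of a piecewise smooth 3-form: the sum over the tetrahedra of K of the integrals of
   its pullbacks along orientation-preserving parametrisations (boundaries are null sets). *)
definition integral_pw ::
    "'m chart set \<Rightarrow> 'b::euclidean_space set set \<Rightarrow> ('b \<Rightarrow> 'm) \<Rightarrow>
     ('b list \<Rightarrow> real^3 \<Rightarrow> form3) \<Rightarrow> real" where
  "integral_pw A K h \<omega> = (\<Sum>T | T \<in> K \<and> 3 simplex T.
     (LINT t:open_tetra|lborel. \<omega> (positive_ordering A K h T) t [axis 1 1, axis 2 1, axis 3 1]))"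

definition whitney_inner ::
    "'m chart set \<Rightarrow> ('m chart \<Rightarrow> real^3 \<Rightarrow> real^3^3) \<Rightarrow> 'b::euclidean_space set set \<Rightarrow> ('b \<Rightarrow> 'm) \<Rightarrow>
     nat \<Rightarrow> ('b list \<Rightarrow> real) \<Rightarrow> ('b list \<Rightarrow> real) \<Rightarrow> real" where
  "whitney_inner A G K h k u v = integral_pw A K h (\<lambda>vs t.
     wedge k (3 - k) (whitney_map K k u vs t)
       (hodge_star (tetra_metric A G h vs t) k (whitney_map K k v vs t)))"


section \<open>Discrete Hodge decomposition\<close>

definition coboundary_adj ::
    "'m chart set \<Rightarrow> ('m chart \<Rightarrow> real^3 \<Rightarrow> real^3^3) \<Rightarrow> 'b::euclidean_space set set \<Rightarrow> ('b \<Rightarrow> 'm) \<Rightarrow>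
     nat \<Rightarrow> ('b list \<Rightarrow> real) \<Rightarrow> 'b list \<Rightarrow> real" where
  "coboundary_adj A G K h k w = (THE w'. w' \<in> cochains K k \<and>
     (\<forall>u\<in>cochains K k. whitney_inner A G K h (Suc k) (coboundary K k u) w =
                        whitney_inner A G K h k u w'))"

definition harmonic1 ::
    "'m chart set \<Rightarrow> ('m chart \<Rightarrow> real^3 \<Rightarrow> real^3^3) \<Rightarrow> 'b::euclidean_space set set \<Rightarrow> ('b \<Rightarrow> 'm) \<Rightarrow>
     ('b list \<Rightarrow> real) set" where
  "harmonic1 A G K h =
     {u \<in> cochains K 1. coboundary K 1 u = (\<lambda>_. 0) \<and> coboundary_adj A G K h 0 u = (\<lambda>_. 0)}"

definition V_p ::
    "'m chart set \<Rightarrow> ('m chart \<Rightarrow> real^3 \<Rightarrow> real^3^3) \<Rightarrow> 'b::euclidean_space set set \<Rightarrow> ('b \<Rightarrow> 'm) \<Rightarrow>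
     ('b list \<Rightarrow> real) set" where
  "V_p A G K h = {\<lambda>s. u s + w s | u w.
     u \<in> harmonic1 A G K h \<and> w \<in> coboundary_adj A G K h 1 ` cochains K 2}"

definition V_g :: "'b::euclidean_space set set \<Rightarrow> ('b list \<Rightarrow> real) set" where
  "V_g K = coboundary K 0 ` cochains K 0"

definition whitney_orthonormal_basis ::
    "'m chart set \<Rightarrow> ('m chart \<Rightarrow> real^3 \<Rightarrow> real^3^3) \<Rightarrow> 'b::euclidean_space set set \<Rightarrow> ('b \<Rightarrow> 'm) \<Rightarrow>
     ('b list \<Rightarrow> real) set \<Rightarrow> ('i::finite \<Rightarrow> 'b list \<Rightarrow> real) \<Rightarrow> bool" where
  "whitney_orthonormal_basis A G K h V e \<longleftrightarrow>
     (\<forall>i. e i \<in> V) \<and>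
     (\<forall>i j. whitney_inner A G K h 1 (e i) (e j) = (if i = j then 1 else 0)) \<and>
     (\<forall>u\<in>V. \<exists>a. u = (\<lambda>s. \<Sum>i\<in>UNIV. a i * e i s))"

definition whitney_coords ::
    "'m chart set \<Rightarrow> ('m chart \<Rightarrow> real^3 \<Rightarrow> real^3^3) \<Rightarrow> 'b::euclidean_space set set \<Rightarrow> ('b \<Rightarrow> 'm) \<Rightarrow>
     ('p::finite \<Rightarrow> 'b list \<Rightarrow> real) \<Rightarrow> ('g::finite \<Rightarrow> 'b list \<Rightarrow> real) \<Rightarrow>
     ('b list \<Rightarrow> real) \<Rightarrow> (real^'p) \<times> (real^'g)" where
  "whitney_coords A G K h ep eg a =
     (\<chi> i. whitney_inner A G K h 1 a (ep i), \<chi> j. whitney_inner A G K h 1 a (eg j))"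

(* The Borel sigma-algebra of the finite-dimensional space of k-cochains. *)
definition cochain_space :: "'b::euclidean_space set set \<Rightarrow> nat \<Rightarrow> ('b list \<Rightarrow> real) measure" where
  "cochain_space K k = restrict_space (PiM UNIV (\<lambda>_. borel)) (cochains K k)"


section \<open>Gaussian measures and Fisher information\<close>

definition join :: "(real^'p) \<times> (real^'g) \<Rightarrow> real^('p + 'g)" where
  "join z = (\<chi> i. case i of Inl a \<Rightarrow> fst z $ a | Inr b \<Rightarrow> snd z $ b)"

definition gaussian_density :: "real^'k \<Rightarrow> real^'k^'k \<Rightarrow> real^'k \<Rightarrow> real" where
  "gaussian_density m S z =
     exp (- ((z - m) \<bullet> (matrix_inv S *v (z - m))) / 2) / sqrt ((2 * pi) ^ CARD('k) * det S)"

definition nondegenerate_gaussian ::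
    "((real^'p) \<times> (real^'g)) measure \<Rightarrow> real^('p + 'g) \<Rightarrow> real^('p + 'g)^('p + 'g) \<Rightarrow> bool" where
  "nondegenerate_gaussian \<nu> m S \<longleftrightarrow>
     pos_def S \<and> \<nu> = density lborel (\<lambda>z. ennreal (gaussian_density m S (join z)))"

definition continuous_density :: "'a::euclidean_space measure \<Rightarrow> ('a \<Rightarrow> real) \<Rightarrow> bool" where
  "continuous_density \<nu> f \<longleftrightarrow>
     continuous_on UNIV f \<and> (\<forall>z. 0 \<le> f z) \<and> \<nu> = density lborel (\<lambda>z. ennreal (f z))"

definition marginal_density ::
    "('a::euclidean_space \<times> 'b::euclidean_space \<Rightarrow> real) \<Rightarrow> 'a \<Rightarrow> real" where
  "marginal_density f x = (LINT y|lborel. f (x, y))"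

definition conditional_density ::
    "('a::euclidean_space \<times> 'b::euclidean_space \<Rightarrow> real) \<Rightarrow> 'a \<Rightarrow> 'b \<Rightarrow> real" where
  "conditional_density f x y = f (x, y) / marginal_density f x"

definition partial :: "'n::finite \<Rightarrow> (real^'n \<Rightarrow> real) \<Rightarrow> real^'n \<Rightarrow> real" where
  "partial i F \<theta> = deriv (\<lambda>t. F (\<theta> + t *\<^sub>R axis i 1)) 0"

definition fisher ::
    "(real^'n::finite \<Rightarrow> 'a::euclidean_space \<Rightarrow> real) \<Rightarrow> real^'n \<Rightarrow> 'n \<Rightarrow> 'n \<Rightarrow> real" where
  "fisher f \<theta> i j = (LINT x|lborel.
     partial i (\<lambda>\<theta>. ln (f \<theta> x)) \<theta> * partial j (\<lambda>\<theta>. ln (f \<theta> x)) \<theta> * f \<theta> x)"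

definition g_aux ::
    "(real^'n::finite \<Rightarrow> 'a::euclidean_space \<times> 'b::euclidean_space \<Rightarrow> real) \<Rightarrow>
     real^'n \<Rightarrow> 'n \<Rightarrow> 'n \<Rightarrow> real" where
  "g_aux f = fisher f"

definition g_phys ::
    "(real^'n::finite \<Rightarrow> 'a::euclidean_space \<times> 'b::euclidean_space \<Rightarrow> real) \<Rightarrow>
     real^'n \<Rightarrow> 'n \<Rightarrow> 'n \<Rightarrow> real" where
  "g_phys f = fisher (\<lambda>\<theta>. marginal_density (f \<theta>))"

definition g_cond ::
    "(real^'n::finite \<Rightarrow> 'a::euclidean_space \<times> 'b::euclidean_space \<Rightarrow> real) \<Rightarrow>
     real^'n \<Rightarrow> 'n \<Rightarrow> 'n \<Rightarrow> real" where
  "g_cond f \<theta> i j = (LINT x|lborel.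
     fisher (\<lambda>\<theta>. conditional_density (f \<theta>) x) \<theta> i j * marginal_density (f \<theta>) x)"

end

theory Submission
  imports "HOL-Probability.Distributions" Defs
begin

text \<open>
  Write \<open>s\<^sub>i\<close> for the score of the joint density \<open>f\<close>, \<open>p\<close> for the marginal density and
  \<open>a\<^sub>i(x) = E[s\<^sub>i | x]\<close>. Differentiating under the integral sign gives \<open>\<partial>\<^sub>i log p = a\<^sub>i\<close>, so the
  score of the conditional density is \<open>s\<^sub>i - a\<^sub>i\<close>. The decomposition is then the law of total
  covariance: \<open>s\<^sub>i - a\<^sub>i\<close> is orthogonal, conditionally on \<open>x\<close>, to functions of \<open>x\<close>, and the
  conditional part is a Gram matrix, hence positive semidefinite. Only three properties of the
  Gaussian family are needed: \<open>log f\<close> is differentiable along each coordinate line, its increments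
  are at most a multiple of \<open>|t| (1 + |z|\<^sup>2)\<close>, and at \<open>\<theta>\<close> it lies below \<open>B - c |z|\<^sup>2\<close>.
\<close>

section \<open>Law of total covariance for scores\<close>

lemma abs_mult_le_half_squares:
  fixes a b :: real
  shows "\<bar>a * b\<bar> \<le> a\<^sup>2 + b\<^sup>2"
proof -
  have "0 \<le> (\<bar>a\<bar> - \<bar>b\<bar>)\<^sup>2" "0 \<le> a\<^sup>2 + b\<^sup>2" by simp_all
  then show ?thesis unfolding power2_diff abs_mult power2_abs by linarith
qed

lemma integrable_weighted_mult:
  fixes f s t :: "'a \<Rightarrow> real"
  assumes [measurable]: "f \<in> borel_measurable M" "s \<in> borel_measurable M" "t \<in> borel_measurable M"
    and pos: "\<And>y. 0 \<le> f y"
    and s: "integrable M (\<lambda>y. (s y)\<^sup>2 * f y)" and t: "integrable M (\<lambda>y. (t y)\<^sup>2 * f y)"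
  shows "integrable M (\<lambda>y. s y * t y * f y)"
proof (rule Bochner_Integration.integrable_bound)
  show "integrable M (\<lambda>y. (s y)\<^sup>2 * f y + (t y)\<^sup>2 * f y)"
    using s t by simp
  show "AE y in M. norm (s y * t y * f y) \<le> norm ((s y)\<^sup>2 * f y + (t y)\<^sup>2 * f y)"
  proof (intro AE_I2)
    fix y
    have "\<bar>s y * t y\<bar> * f y \<le> ((s y)\<^sup>2 + (t y)\<^sup>2) * f y"
      by (intro mult_right_mono abs_mult_le_half_squares pos)
    then show "norm (s y * t y * f y) \<le> norm ((s y)\<^sup>2 * f y + (t y)\<^sup>2 * f y)"
      using pos[of y] by (simp add: abs_mult distrib_right)
  qed
qed simp

text \<open>With the normalised weight \<open>f / p\<close>, \<open>a\<close> and \<open>b\<close>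
  are the means of \<open>s\<close> and \<open>t\<close>. Expanding the product, each of the two
  cross terms contributes \<open>- a * b\<close> and the constant term \<open>+ a * b\<close>, so
  one \<open>- a * b\<close> survives. The equation is multiplied through by \<open>p\<close>
  because it is later integrated over \<open>x\<close> against the marginal density.\<close>

lemma weighted_covariance:
  fixes f s t :: "'a \<Rightarrow> real"
  assumes f: "integrable M f" and pos: "\<And>y. 0 \<le> f y"
    and sm[measurable]: "s \<in> borel_measurable M" and tm[measurable]: "t \<in> borel_measurable M"
    and s: "integrable M (\<lambda>y. (s y)\<^sup>2 * f y)" and t: "integrable M (\<lambda>y. (t y)\<^sup>2 * f y)"
    and p: "p = (\<integral>y. f y \<partial>M)" "p \<noteq> 0"
    and a: "a = (\<integral>y. s y * f y \<partial>M) / p" and b: "b = (\<integral>y. t y * f y \<partial>M) / p"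
  shows "integrable M (\<lambda>y. (s y - a) * (t y - b) * (f y / p))" (is ?int)
    and "(\<integral>y. (s y - a) * (t y - b) * (f y / p) \<partial>M) * p = (\<integral>y. s y * t y * f y \<partial>M) - a * b * p" (is ?eq)
proof -
  have [measurable]: "f \<in> borel_measurable M" using f by simp
  have st: "integrable M (\<lambda>y. s y * t y * f y)"
    by (intro integrable_weighted_mult assms) simp_all
  \<comment> \<open>Integrability of \<open>f\<close> says that the constant 1 is square integrable
    for the weight \<open>f\<close>; pairing it with \<open>s\<close> and \<open>t\<close> yields
    the first moments.\<close>
  have s1: "integrable M (\<lambda>y. s y * f y)" and t1: "integrable M (\<lambda>y. t y * f y)"
    using integrable_weighted_mult[of f M s "\<lambda>_. 1"] integrable_weighted_mult[of f M t "\<lambda>_. 1"] f pos s t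
    by simp_all
  have eq: "(s y - a) * (t y - b) * (f y / p) =
      (s y * t y * f y) / p - (b * (s y * f y)) / p - (a * (t y * f y)) / p + (a * b * f y) / p" for y
    using p(2) by (simp add: field_simps)
  show ?int
    unfolding eq using st s1 t1 f by simp
  have "(\<integral>y. (s y - a) * (t y - b) * (f y / p) \<partial>M) =
      (\<integral>y. s y * t y * f y \<partial>M) / p - b * (a * p) / p - a * (b * p) / p + a * b * p / p"
    unfolding eq using st s1 t1 f p(2) by (simp add: a b p(1)[symmetric])
  then show ?eq using p(2) by (simp add: field_simps)
qed

lemma lborel_integral_pos:
  fixes f :: "'a::euclidean_space \<Rightarrow> real"
  assumes f: "integrable lborel f" and pos: "\<And>x. 0 < f x"
  shows "0 < (\<integral>x. f x \<partial>lborel)"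
proof -
  have nz: "f x \<noteq> 0" for x using pos[of x] by simp
  \<comment> \<open>A zero integral would give \<open>f = 0\<close> almost everywhere. As
    \<open>f\<close> vanishes nowhere, almost every point would satisfy a falsehood, which
    contradicts the non-zero total mass of Lebesgue measure.\<close>
  have "(\<integral>x. f x \<partial>lborel) \<noteq> 0"
    using integral_nonneg_eq_0_iff_AE[OF f] less_imp_le[OF pos]
    by (simp add: nz ae_filter_eq_bot_iff eventually_False)
  moreover have "0 \<le> (\<integral>x. f x \<partial>lborel)" using less_imp_le[OF pos] by simp
  ultimately show ?thesis by simp
qed

text \<open>Here \<open>a i x\<close> is the conditional mean of \<open>s i\<close> given
  \<open>x\<close> and \<open>C i j x\<close> the conditional covariance. Fubini writes the second
  moment as an integral over \<open>x\<close> of slice integrals, and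
  \<open>weighted_covariance\<close> splits each slice. The functions \<open>s i\<close> are
  arbitrary square-integrable ones at this stage; they become scores in
  \<open>fisher_decomposition\<close>.\<close>

lemma fisher_split:
  fixes f :: "'a::euclidean_space \<times> 'b::euclidean_space \<Rightarrow> real"
    and s :: "'n::finite \<Rightarrow> 'a \<times> 'b \<Rightarrow> real"
  assumes f: "integrable lborel f" and pos: "\<And>z. 0 < f z"
    and sm[measurable]: "\<And>i. s i \<in> borel_measurable borel"
    and s2: "\<And>i. integrable lborel (\<lambda>z. (s i z)\<^sup>2 * f z)"
    and p: "\<And>x. p x = (\<integral>y. f (x, y) \<partial>lborel)"
    and a: "\<And>i x. a i x = (\<integral>y. s i (x, y) * f (x, y) \<partial>lborel) / p x"
  defines "C i j x \<equiv> (\<integral>y. (s i (x, y) - a i x) * (s j (x, y) - a j x) * (f (x, y) / p x) \<partial>lborel)"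
  shows "(\<integral>z. s i z * s j z * f z \<partial>lborel) =
      (\<integral>x. a i x * a j x * p x \<partial>lborel) + (\<integral>x. C i j x * p x \<partial>lborel)" (is ?split)
    and "0 \<le> (\<Sum>i\<in>UNIV. \<Sum>j\<in>UNIV. (\<integral>x. C i j x * p x \<partial>lborel) * \<xi> $ i * \<xi> $ j)" (is ?nonneg)
proof -
  have fm[measurable]: "f \<in> borel_measurable borel" using f by simp
  have pm[measurable]: "p \<in> borel_measurable borel" unfolding p[abs_def] by simp
  have am[measurable]: "a i \<in> borel_measurable borel" for i unfolding a[abs_def] by simp
  have sl: "AE x in lborel. integrable lborel (\<lambda>y. f (x, y))"
    using lborel_pair.AE_integrable_fst'[of f] f by (simp add: lborel_prod)
  have sl2: "AE x in lborel. \<forall>i. integrable lborel (\<lambda>y. (s i (x, y))\<^sup>2 * f (x, y))"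
    using lborel_pair.AE_integrable_fst'[of "\<lambda>z. (s i z)\<^sup>2 * f z" for i] s2
    by (intro AE_all_countable[THEN iffD2] allI) (simp add: lborel_prod)
  have sij: "integrable lborel (\<lambda>z. s i z * s j z * f z)" for i j
    using s2 less_imp_le[OF pos] by (intro integrable_weighted_mult) simp_all
  have slij: "integrable lborel (\<lambda>x. \<integral>y. s i (x, y) * s j (x, y) * f (x, y) \<partial>lborel)" 
    and intij: "(\<integral>x. \<integral>y. s i (x, y) * s j (x, y) * f (x, y) \<partial>lborel \<partial>lborel) = (\<integral>z. s i z * s j z * f z \<partial>lborel)" for i j
    using lborel_pair.integrable_fst'[of "\<lambda>z. s i z * s j z * f z"]
      lborel_pair.integral_fst'[of "\<lambda>z. s i z * s j z * f z"] sij[of i j] by (simp_all add: lborel_prod)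
  \<comment> \<open>Where a slice is not integrable, its Bochner integral is 0 by convention and
    \<open>p x = 0\<close>. Such \<open>x\<close> form a null set, which is why the facts about
    slices are stated almost everywhere.\<close>
  have ppos: "AE x in lborel. 0 < p x"
    using sl
  proof eventually_elim
    case (elim x)
    then show ?case using lborel_integral_pos[of "\<lambda>y. f (x, y)"] pos by (simp add: p)
  qed
  \<comment> \<open>The integrability conjunct is kept for the quadratic form below, where finite
    sums are moved into the inner integral.\<close>
  have C: "AE x in lborel. \<forall>i j. C i j x * p x = (\<integral>y. s i (x, y) * s j (x, y) * f (x, y) \<partial>lborel) - a i x * a j x * p x
      \<and> integrable lborel (\<lambda>y. (s i (x, y) - a i x) * (s j (x, y) - a j x) * (f (x, y) / p x))"
    using sl sl2 ppos
  proof eventually_elim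
    case (elim x)
    show ?case
    proof (intro allI conjI)
      fix i j
      note * = weighted_covariance[of lborel "\<lambda>y. f (x, y)" "\<lambda>y. s i (x, y)" "\<lambda>y. s j (x, y)" "p x" "a i x" "a j x"]
      show "C i j x * p x = (\<integral>y. s i (x, y) * s j (x, y) * f (x, y) \<partial>lborel) - a i x * a j x * p x"
        unfolding C_def using elim less_imp_le[OF pos] by (intro *(2) p a) simp_all
      show "integrable lborel (\<lambda>y. (s i (x, y) - a i x) * (s j (x, y) - a j x) * (f (x, y) / p x))"
        using elim less_imp_le[OF pos] by (intro *(1) p a) simp_all
    qed
  qed
  \<comment> \<open>The conditional variance \<open>C i i x\<close> is nonnegative, so
    \<open>(a i x)\<^sup>2 * p x\<close> is at most the slice integral of the squared score, which
    is integrable in \<open>x\<close>.\<close>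
  have aii: "integrable lborel (\<lambda>x. (a i x)\<^sup>2 * p x)" for i
  proof (rule Bochner_Integration.integrable_bound[OF slij[of i i]])
    show "AE x in lborel. norm ((a i x)\<^sup>2 * p x) \<le> norm (\<integral>y. s i (x, y) * s i (x, y) * f (x, y) \<partial>lborel)"
      using C ppos
    proof eventually_elim
      case (elim x)
      have "0 \<le> C i i x" unfolding C_def using less_imp_le[OF pos] elim
        by (intro integral_nonneg_AE AE_I2) simp
      then have "0 \<le> C i i x * p x" using elim(2) by simp
      moreover have "C i i x * p x = (\<integral>y. s i (x, y) * s i (x, y) * f (x, y) \<partial>lborel) - (a i x)\<^sup>2 * p x"
        using elim by (simp add: power2_eq_square)
      moreover have "0 \<le> (a i x)\<^sup>2 * p x" using elim by simp
      ultimately show ?case by simp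
    qed
  qed simp
  have aij: "integrable lborel (\<lambda>x. a i x * a j x * p x)" for i j
  proof -
    \<comment> \<open>\<open>integrable_weighted_mult\<close> asks for a weight that is nonnegative
      everywhere, while \<open>ppos\<close> speaks of almost every \<open>x\<close>; hence the
      detour through the absolute value of \<open>p\<close>.\<close>
    have "integrable lborel (\<lambda>x. (a i x)\<^sup>2 * \<bar>p x\<bar>)" for i
      by (rule integrable_cong_AE_imp[OF aii[of i]]) (use ppos in auto)
    then have "integrable lborel (\<lambda>x. a i x * a j x * \<bar>p x\<bar>)"
      by (intro integrable_weighted_mult) simp_all
    then show ?thesis
      by (rule integrable_cong_AE_imp) (use ppos in auto)
  qed
  have Cm: "(\<lambda>x. C i j x * p x) \<in> borel_measurable lborel" for i j
    unfolding C_def by simp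
  have Ci: "integrable lborel (\<lambda>x. C i j x * p x)" for i j
    by (rule integrable_cong_AE_imp[OF Bochner_Integration.integrable_diff[OF slij[of i j] aij[of i j]]])
       (use C Cm in auto)
  have "(\<integral>x. C i j x * p x \<partial>lborel) = (\<integral>x. (\<integral>y. s i (x, y) * s j (x, y) * f (x, y) \<partial>lborel) - a i x * a j x * p x \<partial>lborel)" for i j
    by (intro integral_cong_AE) (use C Cm in auto)
  then show ?split
    using slij aij intij by simp
  \<comment> \<open>Moving the sums inside both integrals exhibits the form as the
    \<open>p\<close>-weighted integral of the conditional second moment of the single function
    \<Sum>i. \<xi>_i (\<open>s i\<close> - \<open>a i\<close>), whose integrand is a square.\<close>
  have "(\<Sum>i\<in>UNIV. \<Sum>j\<in>UNIV. (\<integral>x. C i j x * p x \<partial>lborel) * \<xi> $ i * \<xi> $ j) =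
      (\<integral>x. (\<Sum>i\<in>UNIV. \<Sum>j\<in>UNIV. C i j x * p x * \<xi> $ i * \<xi> $ j) \<partial>lborel)"
    using Ci by simp
  also have "0 \<le> \<dots>"
  proof (rule integral_nonneg_AE)
    show "AE x in lborel. 0 \<le> (\<Sum>i\<in>UNIV. \<Sum>j\<in>UNIV. C i j x * p x * \<xi> $ i * \<xi> $ j)"
      using C ppos
    proof eventually_elim
      case (elim x)
      let ?c = "\<lambda>i y. s i (x, y) - a i x"
      have "(\<Sum>i\<in>UNIV. \<Sum>j\<in>UNIV. C i j x * \<xi> $ i * \<xi> $ j) =
          (\<integral>y. (\<Sum>i\<in>UNIV. \<Sum>j\<in>UNIV. ?c i y * ?c j y * (f (x, y) / p x) * \<xi> $ i * \<xi> $ j) \<partial>lborel)"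
        unfolding C_def using elim(1) by (simp del: times_divide_eq_right times_divide_eq_left)
      also have "\<dots> = (\<integral>y. (\<Sum>i\<in>UNIV. ?c i y * \<xi> $ i)\<^sup>2 * (f (x, y) / p x) \<partial>lborel)"
        by (simp add: power2_eq_square sum_product sum_distrib_left sum_distrib_right mult_ac)
      also have "0 \<le> \<dots>" using less_imp_le[OF pos] elim by (intro integral_nonneg_AE AE_I2) simp
      finally have "0 \<le> (\<Sum>i\<in>UNIV. \<Sum>j\<in>UNIV. C i j x * \<xi> $ i * \<xi> $ j) * p x" using elim(2) by simp
      then show ?case by (simp add: sum_distrib_right sum_distrib_left mult_ac)
    qed
  qed
  finally show ?nonneg .
qed

section \<open>Differentiation under the integral for Gaussian-type families\<close>

text \<open>The tangent-line inequality for \<open>exp\<close> bounds the difference by the length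
  of the interval times the larger of the two exponentials. Writing that bound as
  \<open>exp (b + \<bar>a - b\<bar>)\<close> keeps the base point \<open>b\<close>, whose decay is
  known, and isolates the increment, whose growth is controlled.\<close>

lemma abs_exp_diff_le:
  fixes a b :: real
  shows "\<bar>exp a - exp b\<bar> \<le> \<bar>a - b\<bar> * exp (b + \<bar>a - b\<bar>)"
proof (cases "b \<le> a")
  case True
  have "exp a * (1 + (b - a)) \<le> exp a * exp (b - a)"
    by (intro mult_left_mono exp_ge_add_one_self) simp
  then have "exp a - exp b \<le> (a - b) * exp a"
    by (simp add: exp_add[symmetric] algebra_simps)
  then show ?thesis using True by simp
next
  case False
  have "exp b * (1 + (a - b)) \<le> exp b * exp (a - b)"
    by (intro mult_left_mono exp_ge_add_one_self) simp
  then have "exp b - exp a \<le> (b - a) * exp b"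
    by (simp add: exp_add[symmetric] algebra_simps)
  also have "\<dots> \<le> (b - a) * exp (b + (b - a))"
    using False by (intro mult_left_mono) auto
  finally show ?thesis using False by simp
qed

lemma integrable_exp_neg_norm_power2:
  assumes c: "0 < c"
  shows "integrable lborel (\<lambda>z::'a::euclidean_space. exp (- c * (norm z)\<^sup>2))"
proof -
  \<comment> \<open>This standard deviation makes the exponent of the normal density equal to
    \<open>- c * x\<^sup>2\<close>; the integral over the whole space then factors into such
    one-dimensional ones.\<close>
  define \<sigma> where "\<sigma> = sqrt (1 / (2 * c))"
  have s2: "\<sigma>\<^sup>2 = 1 / (2 * c)" "0 < \<sigma>" using c by (simp_all add: \<sigma>_def)
  have "integrable lborel (\<lambda>x::real. sqrt (2 * pi * \<sigma>\<^sup>2) * normal_density 0 \<sigma> x)"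
    using s2(2) by (intro integrable_mult_right integrable_normal_density)
  also have "(\<lambda>x. sqrt (2 * pi * \<sigma>\<^sup>2) * normal_density 0 \<sigma> x) = (\<lambda>x. exp (- c * x\<^sup>2))"
    using c by (simp add: normal_density_def s2 fun_eq_iff)
  finally have fin: "(\<integral>\<^sup>+x. ennreal (exp (- c * x\<^sup>2)) \<partial>(lborel :: real measure)) < \<infinity>"
    by (simp add: integrable_iff_bounded)
  have "exp (- c * (norm z)\<^sup>2) = (\<Prod>b\<in>Basis. exp (- c * (z \<bullet> b)\<^sup>2))" for z :: 'a
    by (simp add: exp_sum[symmetric] sum_distrib_left[symmetric] norm_eq_sqrt_inner
      euclidean_inner[of z z] power2_eq_square sum_nonneg sum_negf)
  then have "(\<integral>\<^sup>+z. ennreal (exp (- c * (norm z)\<^sup>2)) \<partial>(lborel :: 'a measure)) =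
      (\<integral>\<^sup>+z. (\<Prod>b\<in>Basis. ennreal (exp (- c * (z \<bullet> b)\<^sup>2))) \<partial>(lborel :: 'a measure))"
    by (simp add: prod_ennreal)
  also have "\<dots> = (\<Prod>b\<in>(Basis::'a set). \<integral>\<^sup>+x. ennreal (exp (- c * x\<^sup>2)) \<partial>(lborel :: real measure))"
    by (intro nn_integral_lborel_prod) simp_all
  also have "\<dots> < \<infinity>"
    using fin by (simp add: power_less_top_ennreal)
  finally show ?thesis by (simp add: integrable_iff_bounded)
qed

lemma integrable_polynomial_gaussian:
  assumes c: "0 < c"
  shows "integrable lborel (\<lambda>z::'a::euclidean_space. (1 + (norm z)\<^sup>2) ^ k * exp (- c * (norm z)\<^sup>2))"
proof -
  \<comment> \<open>Half of the decay rate absorbs the polynomial. The bound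
    \<open>d \<le> 1\<close> gives \<open>d * (1 + r) \<le> 1 + d * r \<le> exp (d * r)\<close>, and
    the second entry of the minimum makes the \<open>k\<close>-th power of this cost at most
    \<open>c / 2\<close> in the exponent; \<open>real k + 1\<close> keeps the quotient meaningful
    for \<open>k = 0\<close>.\<close>
  define d where "d = min 1 (c / (2 * (real k + 1)))"
  have d: "0 < d" "d \<le> 1" "real k * d \<le> c / 2"
  proof -
    show "0 < d" "d \<le> 1" using c by (simp_all add: d_def)
    have "real k * d \<le> real k * (c / (2 * (real k + 1)))"
      by (intro mult_left_mono) (simp_all add: d_def)
    also have "\<dots> \<le> c / 2" using c by (simp add: field_simps)
    finally show "real k * d \<le> c / 2" .
  qed
  have *: "(1 + r) ^ k * exp (- c * r) \<le> (1 / d ^ k) * exp (- (c / 2) * r)" if "0 \<le> r" for r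
  proof -
    have "d * (1 + r) \<le> 1 + d * r" using d by (simp add: algebra_simps)
    also have "\<dots> \<le> exp (d * r)" by simp
    finally have "(d * (1 + r)) ^ k \<le> exp (d * r) ^ k"
      using d that by (intro power_mono) simp_all
    also have "\<dots> = exp (real k * d * r)" by (simp add: exp_of_nat_mult[symmetric] mult_ac)
    also have "\<dots> \<le> exp (c / 2 * r)" using mult_right_mono[OF d(3) that] by simp
    finally have "(1 + r) ^ k \<le> (1 / d ^ k) * exp (c / 2 * r)"
      using d(1) by (simp only: power_mult_distrib) (simp add: field_simps)
    then have "(1 + r) ^ k * exp (- c * r) \<le> (1 / d ^ k) * exp (c / 2 * r) * exp (- c * r)"
      by (intro mult_right_mono) simp_all
    also have "\<dots> = (1 / d ^ k) * exp (- (c / 2) * r)"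
      by (simp add: exp_add[symmetric])
    finally show ?thesis .
  qed
  show ?thesis
  proof (rule Bochner_Integration.integrable_bound)
    show "integrable lborel (\<lambda>z::'a. (1 / d ^ k) * exp (- (c / 2) * (norm z)\<^sup>2))"
      using c by (intro integrable_mult_right integrable_exp_neg_norm_power2) simp
    show "AE z::'a in lborel. norm ((1 + (norm z)\<^sup>2) ^ k * exp (- c * (norm z)\<^sup>2)) \<le>
        norm ((1 / d ^ k) * exp (- (c / 2) * (norm z)\<^sup>2))"
    proof (rule AE_I2)
      fix z :: 'a
      show "norm ((1 + (norm z)\<^sup>2) ^ k * exp (- c * (norm z)\<^sup>2)) \<le>
        norm ((1 / d ^ k) * exp (- (c / 2) * (norm z)\<^sup>2))"
        using *[of "(norm z)\<^sup>2"] d by (simp add: abs_mult)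
    qed
  qed simp
qed

text \<open>The factor 1 + |x|^2 + |y|^2 is at most (1 + |x|^2)(1 + |y|^2), and the part of the
  exponential depending on \<open>x\<close> is at most 1. Fubini would give this for almost every
  \<open>x\<close>; the marginal score is computed at every \<open>x\<close>.\<close>

lemma integrable_polynomial_gaussian_slice:
  fixes x :: "'a::euclidean_space"
  assumes c: "0 < c"
  shows "integrable lborel (\<lambda>y::'b::euclidean_space. (1 + (norm (x, y))\<^sup>2) ^ k * exp (- c * (norm (x, y))\<^sup>2))"
proof (rule Bochner_Integration.integrable_bound)
  show "integrable lborel (\<lambda>y::'b. (1 + (norm x)\<^sup>2) ^ k * ((1 + (norm y)\<^sup>2) ^ k * exp (- c * (norm y)\<^sup>2)))"
    using c by (intro integrable_mult_right integrable_polynomial_gaussian)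
  have "1 + (norm (x, y))\<^sup>2 \<le> (1 + (norm x)\<^sup>2) * (1 + (norm y)\<^sup>2)" for y :: 'b
    by (simp add: norm_Pair algebra_simps)
  then have "(1 + (norm (x, y))\<^sup>2) ^ k * exp (- c * (norm (x, y))\<^sup>2) \<le>
      ((1 + (norm x)\<^sup>2) * (1 + (norm y)\<^sup>2)) ^ k * exp (- c * (norm y)\<^sup>2)" for y :: 'b
    using c by (intro mult_mono power_mono) (simp_all add: norm_Pair)
  then show "AE y::'b in lborel. norm ((1 + (norm (x, y))\<^sup>2) ^ k * exp (- c * (norm (x, y))\<^sup>2)) \<le>
      norm ((1 + (norm x)\<^sup>2) ^ k * ((1 + (norm y)\<^sup>2) ^ k * exp (- c * (norm y)\<^sup>2)))"
    by (intro AE_I2) (simp add: abs_mult power_mult_distrib mult_ac)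
qed simp

text \<open>The hypotheses concern the base point 0: a derivative at \<open>t = 0\<close> and
  increments from \<open>F 0\<close>. Dividing the increment bound by |t| makes \<open>w\<close> a
  majorant of the difference quotients, so dominated convergence applies along every sequence
  tending to 0.\<close>

lemma has_derivative_integral_dominated:
  fixes F :: "real \<Rightarrow> 'a \<Rightarrow> real"
  assumes \<epsilon>: "0 < \<epsilon>"
    and meas: "\<And>t. \<bar>t\<bar> < \<epsilon> \<Longrightarrow> F t \<in> borel_measurable M"
    and F0: "integrable M (F 0)" and w: "integrable M w"
    and bound: "\<And>t y. \<bar>t\<bar> < \<epsilon> \<Longrightarrow> \<bar>F t y - F 0 y\<bar> \<le> \<bar>t\<bar> * w y"
    and D: "\<And>y. ((\<lambda>t. F t y) has_real_derivative D y) (at 0)"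
    and Dm: "D \<in> borel_measurable M"
  shows "((\<lambda>t. \<integral>y. F t y \<partial>M) has_real_derivative (\<integral>y. D y \<partial>M)) (at 0)"
proof -
  have int: "integrable M (F t)" if t: "\<bar>t\<bar> < \<epsilon>" for t
  proof -
    have "integrable M (\<lambda>y. F t y - F 0 y)"
    proof (rule Bochner_Integration.integrable_bound)
      show "integrable M (\<lambda>y. \<bar>t\<bar> * w y)" using w by simp
      show "(\<lambda>y. F t y - F 0 y) \<in> borel_measurable M" using meas[OF t] F0 by simp
      show "AE y in M. norm (F t y - F 0 y) \<le> norm (\<bar>t\<bar> * w y)"
        using bound[OF t] by (intro AE_I2) (fastforce intro: order_trans)
    qed
    from Bochner_Integration.integrable_add[OF this F0] show ?thesis by simp
  qed
  have "((\<lambda>t. ((\<integral>y. F t y \<partial>M) - (\<integral>y. F 0 y \<partial>M)) / t) \<longlongrightarrow> (\<integral>y. D y \<partial>M)) (at 0 within {-\<epsilon><..<\<epsilon>})"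
    unfolding tendsto_at_iff_sequentially
  proof (intro allI impI)
    fix X :: "nat \<Rightarrow> real" assume X: "\<forall>i. X i \<in> {-\<epsilon><..<\<epsilon>} - {0}" "X \<longlonglongrightarrow> 0"
    have Xi: "\<bar>X i\<bar> < \<epsilon>" "X i \<noteq> 0" for i using X(1)[rule_format, of i] by auto
    have "(\<lambda>i. \<integral>y. (F (X i) y - F 0 y) / X i \<partial>M) \<longlonglongrightarrow> (\<integral>y. D y \<partial>M)"
    proof (rule integral_dominated_convergence[where w = w])
      show "(\<lambda>y. (F (X i) y - F 0 y) / X i) \<in> borel_measurable M" for i
        using meas[OF Xi(1)] F0 by simp
      show "AE y in M. norm ((F (X i) y - F 0 y) / X i) \<le> w y" for i
        using bound[OF Xi(1)] Xi(2)[of i] by (intro AE_I2) (simp add: field_simps)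
      show "AE y in M. (\<lambda>i. (F (X i) y - F 0 y) / X i) \<longlonglongrightarrow> D y"
      proof (rule AE_I2)
        fix y
        have "((\<lambda>t. (F t y - F 0 y) / t) \<longlongrightarrow> D y) (at 0)"
          using D[of y] by (simp add: has_field_derivative_iff)
        then show "(\<lambda>i. (F (X i) y - F 0 y) / X i) \<longlonglongrightarrow> D y"
          using X(2) Xi(2) unfolding tendsto_at_iff_sequentially by (auto simp: comp_def)
      qed
    qed (use Dm w in simp_all)
    moreover have "(\<integral>y. (F (X i) y - F 0 y) / X i \<partial>M) = ((\<integral>y. F (X i) y \<partial>M) - (\<integral>y. F 0 y \<partial>M)) / X i" for i
      by (simp only: integral_divide_zero Bochner_Integration.integral_diff[OF int[OF Xi(1)] F0])
    ultimately show "((\<lambda>t. ((\<integral>y. F t y \<partial>M) - (\<integral>y. F 0 y \<partial>M)) / t) \<circ> X) \<longlonglongrightarrow> (\<integral>y. D y \<partial>M)"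
      by (simp only: comp_def)
  qed
  moreover have "at 0 within {-\<epsilon><..<\<epsilon>} = at (0::real)"
    using \<epsilon> by (intro at_within_open) auto
  ultimately show ?thesis by (simp add: has_field_derivative_iff)
qed

text \<open>Here \<open>u t\<close> is a log density. For small \<open>t\<close> its increment grows
  at most like \<open>(c / 2) * (1 + (norm z)\<^sup>2)\<close>, which uses up half of the decay of
  \<open>u 0\<close>, and \<open>abs_exp_diff_le\<close> does the rest. The squared score needs the
  second power of \<open>1 + (norm z)\<^sup>2\<close>; the other two bounds are padded to share the
  majorant.\<close>

lemma gaussian_type_dominated:
  fixes u :: "real \<Rightarrow> 'a::euclidean_space \<Rightarrow> real"
  assumes lip: "\<forall>\<^sub>F t in nhds 0. \<forall>z. \<bar>u t z - u 0 z\<bar> \<le> C * \<bar>t\<bar> * (1 + (norm z)\<^sup>2)"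
    and s: "\<And>z. ((\<lambda>t. u t z) has_real_derivative s z) (at 0)"
    and c: "0 < c" and dec: "\<And>z. u 0 z \<le> B - c * (norm z)\<^sup>2"
  obtains \<epsilon> D d where "0 < \<epsilon>" "0 < d"
    "\<And>t z. \<bar>t\<bar> < \<epsilon> \<Longrightarrow> \<bar>exp (u t z) - exp (u 0 z)\<bar> \<le> \<bar>t\<bar> * (D * ((1 + (norm z)\<^sup>2)\<^sup>2 * exp (- d * (norm z)\<^sup>2)))"
    "\<And>z. exp (u 0 z) \<le> D * ((1 + (norm z)\<^sup>2)\<^sup>2 * exp (- d * (norm z)\<^sup>2))"
    "\<And>z. (s z)\<^sup>2 * exp (u 0 z) \<le> D * ((1 + (norm z)\<^sup>2)\<^sup>2 * exp (- d * (norm z)\<^sup>2))"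
proof -
  \<comment> \<open>A positive constant is needed, since \<epsilon> is defined by dividing by
    it.\<close>
  define C' where "C' = max C 1"
  have C': "0 < C'" "C \<le> C'" by (simp_all add: C'_def)
  obtain \<epsilon>0 where \<epsilon>0: "0 < \<epsilon>0" and lip0: "\<And>t z. \<bar>t\<bar> < \<epsilon>0 \<Longrightarrow> \<bar>u t z - u 0 z\<bar> \<le> C * \<bar>t\<bar> * (1 + (norm z)\<^sup>2)"
    using lip by (auto simp: eventually_nhds_metric dist_real_def)
  have lip': "\<bar>u t z - u 0 z\<bar> \<le> C' * \<bar>t\<bar> * (1 + (norm z)\<^sup>2)" if "\<bar>t\<bar> < \<epsilon>0" for t z
    by (rule order_trans[OF lip0[OF that]]) (use C' in \<open>intro mult_right_mono, auto\<close>)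
  define \<epsilon> where "\<epsilon> = min \<epsilon>0 (c / (2 * C'))"
  have \<epsilon>: "0 < \<epsilon>" "\<epsilon> \<le> \<epsilon>0" "C' * \<epsilon> \<le> c / 2"
  proof -
    show "0 < \<epsilon>" "\<epsilon> \<le> \<epsilon>0" using \<epsilon>0 c C' by (simp_all add: \<epsilon>_def)
    have "C' * \<epsilon> \<le> C' * (c / (2 * C'))" using C' by (intro mult_left_mono) (simp_all add: \<epsilon>_def)
    then show "C' * \<epsilon> \<le> c / 2" using C' by simp
  qed
  \<comment> \<open>The summands serve the increment (\<open>C'\<close>), the density itself (1) and
    the squared score (\<open>C'\<^sup>2\<close>). In the exponent, \<open>c / 2\<close> is the
    constant part of \<open>(c / 2) * (1 + r)\<close>.\<close>
  define D where "D = (C' + 1 + C'\<^sup>2) * exp (B + c / 2)"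
  have D: "k * exp (B + c / 2) * (1 + r) ^ l * exp (- (c / 2) * r) \<le> D * ((1 + r)\<^sup>2 * exp (- (c / 2) * r))"
    if "k \<le> C' + 1 + C'\<^sup>2" "l \<le> 2" "0 \<le> r" "0 \<le> k" for k r l
    unfolding D_def mult.assoc[symmetric] using that C'
    by (intro mult_right_mono mult_mono power_increasing) simp_all
  have ub: "exp (u 0 z) \<le> exp (B + c / 2) * exp (- (c / 2) * (norm z)\<^sup>2)" for z
  proof -
    have "u 0 z \<le> B + c / 2 - c * (norm z)\<^sup>2 / 2"
      using dec[of z] c mult_nonneg_nonneg[OF less_imp_le[OF c] zero_le_power2[of "norm z"]] by linarith
    then show ?thesis unfolding exp_add[symmetric] by simp
  qed
  \<comment> \<open>The score inherits its quadratic growth as the limit of difference quotients,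
    each of which obeys the increment bound.\<close>
  have sb: "\<bar>s z\<bar> \<le> C' * (1 + (norm z)\<^sup>2)" for z
  proof (rule tendsto_upperbound)
    show "((\<lambda>t. \<bar>(u t z - u 0 z) / t\<bar>) \<longlongrightarrow> \<bar>s z\<bar>) (at 0)"
      using s[of z] by (intro tendsto_rabs) (simp add: has_field_derivative_iff)
    have "\<forall>\<^sub>F t in at 0. \<bar>t\<bar> < \<epsilon>0 \<and> t \<noteq> (0::real)"
      using \<epsilon>0 by (auto simp: eventually_at dist_real_def)
    then show "\<forall>\<^sub>F t in at 0. \<bar>(u t z - u 0 z) / t\<bar> \<le> C' * (1 + (norm z)\<^sup>2)"
    proof eventually_elim
      case (elim t)
      then show ?case using lip'[of t z] by (simp add: field_simps)
    qed
  qed simp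
  show ?thesis
  proof
    show "0 < \<epsilon>" by (rule \<epsilon>)
    show "0 < c / 2" using c by simp
    show "\<bar>exp (u t z) - exp (u 0 z)\<bar> \<le> \<bar>t\<bar> * (D * ((1 + (norm z)\<^sup>2)\<^sup>2 * exp (- (c / 2) * (norm z)\<^sup>2)))" if t: "\<bar>t\<bar> < \<epsilon>" for t z
    proof -
      let ?r = "(norm z)\<^sup>2" and ?d = "\<bar>u t z - u 0 z\<bar>"
      have d: "?d \<le> C' * \<bar>t\<bar> * (1 + ?r)" using lip' t \<epsilon> by simp
      also have "C' * \<bar>t\<bar> * (1 + ?r) \<le> C' * \<epsilon> * (1 + ?r)"
        using t C' by (intro mult_right_mono mult_left_mono) simp_all
      also have "\<dots> \<le> (c / 2) * (1 + ?r)" using \<epsilon> by (intro mult_right_mono) simp_all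
      finally have "u 0 z + ?d \<le> B + c / 2 + - (c / 2) * ?r"
        using dec[of z] by (simp add: field_simps)
      then have "exp (u 0 z + ?d) \<le> exp (B + c / 2) * exp (- (c / 2) * ?r)"
        unfolding exp_add[symmetric] by simp
      with d have "?d * exp (u 0 z + ?d) \<le> C' * \<bar>t\<bar> * (1 + ?r) * (exp (B + c / 2) * exp (- (c / 2) * ?r))"
        using C' by (intro mult_mono) simp_all
      also have "\<dots> = \<bar>t\<bar> * (C' * exp (B + c / 2) * (1 + ?r) ^ 1 * exp (- (c / 2) * ?r))" by simp
      also have "\<dots> \<le> \<bar>t\<bar> * (D * ((1 + ?r)\<^sup>2 * exp (- (c / 2) * ?r)))"
        using C' by (intro mult_left_mono D) simp_all
      finally show ?thesis by (rule order_trans[OF abs_exp_diff_le])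
    qed
    show "exp (u 0 z) \<le> D * ((1 + (norm z)\<^sup>2)\<^sup>2 * exp (- (c / 2) * (norm z)\<^sup>2))" for z
    proof -
      have "exp (u 0 z) \<le> 1 * exp (B + c / 2) * (1 + (norm z)\<^sup>2) ^ 0 * exp (- (c / 2) * (norm z)\<^sup>2)"
        using ub[of z] by simp
      also have "\<dots> \<le> D * ((1 + (norm z)\<^sup>2)\<^sup>2 * exp (- (c / 2) * (norm z)\<^sup>2))"
        using C' by (intro D) simp_all
      finally show ?thesis .
    qed
    show "(s z)\<^sup>2 * exp (u 0 z) \<le> D * ((1 + (norm z)\<^sup>2)\<^sup>2 * exp (- (c / 2) * (norm z)\<^sup>2))" for z
    proof -
      have "(s z)\<^sup>2 * exp (u 0 z) \<le> (C' * (1 + (norm z)\<^sup>2))\<^sup>2 * (exp (B + c / 2) * exp (- (c / 2) * (norm z)\<^sup>2))"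
        using ub sb[of z] power_mono[OF sb[of z] abs_ge_zero, of 2] by (intro mult_mono) simp_all
      also have "\<dots> = C'\<^sup>2 * exp (B + c / 2) * (1 + (norm z)\<^sup>2)\<^sup>2 * exp (- (c / 2) * (norm z)\<^sup>2)"
        by (simp add: power_mult_distrib)
      also have "\<dots> \<le> D * ((1 + (norm z)\<^sup>2)\<^sup>2 * exp (- (c / 2) * (norm z)\<^sup>2))"
        using C' by (intro D) simp_all
      finally show ?thesis .
    qed
  qed
qed

text \<open>Differentiation under the integral gives the derivative of the marginal as the slice
  integral of \<open>s\<close> times \<open>f\<close>; the logarithmic derivative divides it by the
  marginal and is the conditional mean of the score. Subtracting it from \<open>s\<close> gives the
  conditional score, because the log conditional density is the log joint density minus the log
  marginal density. The majorant is integrable on every slice, so the formulas hold at every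
  point.\<close>

lemma gaussian_type_score:
  fixes f :: "real^'n::finite \<Rightarrow> 'a::euclidean_space \<times> 'b::euclidean_space \<Rightarrow> real"
  assumes meas: "\<forall>\<^sub>F t in nhds 0. f (\<theta> + t *\<^sub>R axis i 1) \<in> borel_measurable borel"
    and pos: "\<forall>\<^sub>F t in nhds 0. \<forall>z. 0 < f (\<theta> + t *\<^sub>R axis i 1) z"
    and lip: "\<forall>\<^sub>F t in nhds 0. \<forall>z. \<bar>ln (f (\<theta> + t *\<^sub>R axis i 1) z) - ln (f \<theta> z)\<bar> \<le> C * \<bar>t\<bar> * (1 + (norm z)\<^sup>2)"
    and s: "\<And>z. ((\<lambda>t. ln (f (\<theta> + t *\<^sub>R axis i 1) z)) has_real_derivative s z) (at 0)"
    and c: "0 < c" and dec: "\<And>z. ln (f \<theta> z) \<le> B - c * (norm z)\<^sup>2"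
    and sm[measurable]: "s \<in> borel_measurable borel"
  shows "integrable lborel (f \<theta>)" and "integrable lborel (\<lambda>z. (s z)\<^sup>2 * f \<theta> z)"
    and "partial i (\<lambda>\<theta>. ln (f \<theta> z)) \<theta> = s z"
    and "partial i (\<lambda>\<theta>. ln (marginal_density (f \<theta>) x)) \<theta> =
      (\<integral>y. s (x, y) * f \<theta> (x, y) \<partial>lborel) / marginal_density (f \<theta>) x" (is "?pm x")
    and "partial i (\<lambda>\<theta>. ln (conditional_density (f \<theta>) x y)) \<theta> =
      s (x, y) - (\<integral>y. s (x, y) * f \<theta> (x, y) \<partial>lborel) / marginal_density (f \<theta>) x" (is "?pc x y")
proof -
  let ?f = "\<lambda>t. f (\<theta> + t *\<^sub>R axis i 1)"
  note split_paired_All[simp del]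
  have fm[measurable]: "f \<theta> \<in> borel_measurable borel"
    using eventually_nhds_x_imp_x[OF meas] by simp
  have fpos: "0 < f \<theta> z" for z
    using eventually_nhds_x_imp_x[OF pos, THEN spec, of z] by simp
  obtain \<epsilon>0 D d where \<epsilon>0: "0 < \<epsilon>0" and d: "0 < d"
    and diff: "\<And>t z. \<bar>t\<bar> < \<epsilon>0 \<Longrightarrow> \<bar>exp (ln (?f t z)) - exp (ln (?f 0 z))\<bar> \<le> \<bar>t\<bar> * (D * ((1 + (norm z)\<^sup>2)\<^sup>2 * exp (- d * (norm z)\<^sup>2)))"
    and b0: "\<And>z. exp (ln (?f 0 z)) \<le> D * ((1 + (norm z)\<^sup>2)\<^sup>2 * exp (- d * (norm z)\<^sup>2))"
    and b2: "\<And>z. (s z)\<^sup>2 * exp (ln (?f 0 z)) \<le> D * ((1 + (norm z)\<^sup>2)\<^sup>2 * exp (- d * (norm z)\<^sup>2))"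
  proof (rule gaussian_type_dominated)
    show "\<forall>\<^sub>F t in nhds 0. \<forall>z. \<bar>ln (?f t z) - ln (?f 0 z)\<bar> \<le> C * \<bar>t\<bar> * (1 + (norm z)\<^sup>2)"
      using lip by simp
    show "\<And>z. ((\<lambda>t. ln (?f t z)) has_real_derivative s z) (at 0)" by (rule s)
    show "\<And>z. ln (?f 0 z) \<le> B - c * (norm z)\<^sup>2" using dec by simp
  qed (use c that in blast)+
  define W where "W z = D * ((1 + (norm z)\<^sup>2)\<^sup>2 * exp (- d * (norm z)\<^sup>2))" for z :: "'a \<times> 'b"
  have W: "integrable lborel W" "integrable lborel (\<lambda>y. W (x, y))" for x
    unfolding W_def using d
    by (intro integrable_mult_right integrable_polynomial_gaussian integrable_polynomial_gaussian_slice; simp)+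
  have fW: "\<bar>f \<theta> z\<bar> \<le> \<bar>W z\<bar>" "\<bar>(s z)\<^sup>2 * f \<theta> z\<bar> \<le> \<bar>W z\<bar>" for z
  proof -
    have "f \<theta> z \<le> W z" "(s z)\<^sup>2 * f \<theta> z \<le> W z" "0 \<le> (s z)\<^sup>2 * f \<theta> z"
      using b0[of z] b2[of z] fpos[of z] by (simp_all add: W_def)
    with fpos[of z] show "\<bar>f \<theta> z\<bar> \<le> \<bar>W z\<bar>" "\<bar>(s z)\<^sup>2 * f \<theta> z\<bar> \<le> \<bar>W z\<bar>"
      by linarith+
  qed
  show "integrable lborel (f \<theta>)"
    by (rule Bochner_Integration.integrable_bound[OF W(1)]) (simp, intro AE_I2, unfold real_norm_def, rule fW)
  show "integrable lborel (\<lambda>z. (s z)\<^sup>2 * f \<theta> z)"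
    by (rule Bochner_Integration.integrable_bound[OF W(1)]) (simp, intro AE_I2, unfold real_norm_def, rule fW)
  have sl: "integrable lborel (\<lambda>y. f \<theta> (x, y))" for x
    by (rule Bochner_Integration.integrable_bound[OF W(2)]) (simp, intro AE_I2, unfold real_norm_def, rule fW)
  have ps: "partial i (\<lambda>\<theta>. ln (f \<theta> z)) \<theta> = s z" for z
    unfolding partial_def by (rule DERIV_imp_deriv[OF s])
  then show "partial i (\<lambda>\<theta>. ln (f \<theta> z)) \<theta> = s z" .
  \<comment> \<open>The hypotheses control logarithms. The density is recovered as
    \<open>exp (ln (?f t z))\<close>, which is legitimate for \<open>t\<close> near 0, where it is
    positive.\<close>
  have Df: "((\<lambda>t. ?f t z) has_real_derivative s z * f \<theta> z) (at 0)" for z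
  proof -
    have "((\<lambda>t. exp (ln (?f t z))) has_real_derivative exp (ln (?f 0 z)) * s z) (at 0)"
      by (rule DERIV_fun_exp[OF s])
    moreover have "\<forall>\<^sub>F t in nhds 0. exp (ln (?f t z)) = ?f t z"
      using pos by (rule eventually_mono) simp
    ultimately have "((\<lambda>t. ?f t z) has_real_derivative exp (ln (?f 0 z)) * s z) (at 0)"
      by (rule DERIV_cong_ev[OF refl _ refl, THEN iffD1, rotated])
    then show ?thesis using fpos[of z] by (simp add: mult.commute)
  qed
  obtain \<epsilon>1 where \<epsilon>1: "0 < \<epsilon>1" "\<And>t. \<bar>t\<bar> < \<epsilon>1 \<Longrightarrow> ?f t \<in> borel_measurable borel \<and> (\<forall>z. 0 < ?f t z)"
    using eventually_conj[OF meas pos] by (auto simp: eventually_nhds_metric dist_real_def)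
  have Dm: "((\<lambda>t. marginal_density (?f t) x) has_real_derivative (\<integral>y. s (x, y) * f \<theta> (x, y) \<partial>lborel)) (at 0)" for x
    unfolding marginal_density_def
  proof (rule has_derivative_integral_dominated[where \<epsilon> = "min \<epsilon>0 \<epsilon>1" and w = "\<lambda>y. W (x, y)"])
    fix t :: real and y assume t: "\<bar>t\<bar> < min \<epsilon>0 \<epsilon>1"
    show "\<bar>?f t (x, y) - ?f 0 (x, y)\<bar> \<le> \<bar>t\<bar> * W (x, y)"
      using diff[of t "(x, y)"] t \<epsilon>1(2)[of t] fpos by (simp add: W_def)
  next
    fix t :: real assume t: "\<bar>t\<bar> < min \<epsilon>0 \<epsilon>1"
    then have [measurable]: "?f t \<in> borel_measurable borel" using \<epsilon>1(2) by simp
    show "(\<lambda>y. ?f t (x, y)) \<in> borel_measurable lborel" by simp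
  qed (use \<epsilon>0 \<epsilon>1 sl W Df in simp_all)
  have mpos: "0 < marginal_density (f \<theta>) x" for x
    unfolding marginal_density_def using sl fpos by (rule lborel_integral_pos)
  have Dlm: "((\<lambda>t. ln (marginal_density (?f t) x)) has_real_derivative
      (\<integral>y. s (x, y) * f \<theta> (x, y) \<partial>lborel) / marginal_density (f \<theta>) x) (at 0)" for x
    using Dm[of x] mpos[of x] by (auto intro!: derivative_eq_intros)
  then show "?pm x" unfolding partial_def by (rule DERIV_imp_deriv)
  \<comment> \<open>Positivity at \<open>t = 0\<close> spreads to nearby \<open>t\<close> by
    continuity, which follows from \<open>Dm\<close>. It allows the logarithm of the quotient to be
    split.\<close>
  have "\<forall>\<^sub>F t in nhds 0. 0 < marginal_density (?f t) x"
  proof -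
    have "isCont (\<lambda>t. marginal_density (?f t) x) 0" using Dm by (rule DERIV_isCont)
    then have "\<forall>\<^sub>F t in at 0. 0 < marginal_density (?f t) x"
      using mpos[of x] by (intro order_tendstoD(1)) (simp_all add: isCont_def)
    then show ?thesis using mpos by (simp add: eventually_nhds_conv_at)
  qed
  with pos have "\<forall>\<^sub>F t in nhds 0. ln (?f t (x, y)) - ln (marginal_density (?f t) x) =
      ln (conditional_density (?f t) x y)"
  proof eventually_elim
    case (elim t)
    have "0 < ?f t (x, y)" using elim(1) by blast
    then show ?case using elim(2) by (simp add: conditional_density_def ln_div)
  qed
  then have "((\<lambda>t. ln (conditional_density (?f t) x y)) has_real_derivative
      s (x, y) - (\<integral>y. s (x, y) * f \<theta> (x, y) \<partial>lborel) / marginal_density (f \<theta>) x) (at 0)"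
    by (rule DERIV_cong_ev[OF refl _ refl, THEN iffD1]) (intro DERIV_diff s Dlm)
  then show "?pc x y" unfolding partial_def by (rule DERIV_imp_deriv)
qed

lemma fisher_decomposition:
  fixes f :: "real^'n::finite \<Rightarrow> 'a::euclidean_space \<times> 'b::euclidean_space \<Rightarrow> real"
  assumes meas: "\<And>i. \<forall>\<^sub>F t in nhds 0. f (\<theta> + t *\<^sub>R axis i 1) \<in> borel_measurable borel"
    and pos: "\<And>i. \<forall>\<^sub>F t in nhds 0. \<forall>z. 0 < f (\<theta> + t *\<^sub>R axis i 1) z"
    and lip: "\<And>i. \<exists>C. \<forall>\<^sub>F t in nhds 0. \<forall>z. \<bar>ln (f (\<theta> + t *\<^sub>R axis i 1) z) - ln (f \<theta> z)\<bar> \<le> C * \<bar>t\<bar> * (1 + (norm z)\<^sup>2)"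
    and s: "\<And>i z. ((\<lambda>t. ln (f (\<theta> + t *\<^sub>R axis i 1) z)) has_real_derivative s i z) (at 0)"
    and c: "0 < c" and dec: "\<And>z. ln (f \<theta> z) \<le> B - c * (norm z)\<^sup>2"
    and sm: "\<And>i. s i \<in> borel_measurable borel"
  shows "g_aux f \<theta> i j = g_phys f \<theta> i j + g_cond f \<theta> i j"
    and "0 \<le> (\<Sum>i\<in>UNIV. \<Sum>j\<in>UNIV. g_cond f \<theta> i j * \<xi> $ i * \<xi> $ j)"
proof -
  have "\<exists>C. \<forall>i. \<forall>\<^sub>F t in nhds 0. \<forall>z. \<bar>ln (f (\<theta> + t *\<^sub>R axis i 1) z) - ln (f \<theta> z)\<bar> \<le> C i * \<bar>t\<bar> * (1 + (norm z)\<^sup>2)"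
    by (intro choice allI lip)
  then obtain C where lip': "\<And>i. \<forall>\<^sub>F t in nhds 0. \<forall>z.
      \<bar>ln (f (\<theta> + t *\<^sub>R axis i 1) z) - ln (f \<theta> z)\<bar> \<le> C i * \<bar>t\<bar> * (1 + (norm z)\<^sup>2)"
    by blast
  note S = gaussian_type_score[where f = f and \<theta> = \<theta> and i = i and C = "C i" and s = "s i" and c = c and B = B for i, OF meas pos lip' s c dec sm]
  have fpos: "0 < f \<theta> z" for z
    \<comment> \<open>Any coordinate direction will do: at \<open>t = 0\<close> each line passes
      through \<theta>.\<close>
    using eventually_nhds_x_imp_x[OF pos[of undefined], THEN spec, of z] by simp
  define p where "p = marginal_density (f \<theta>)"
  define a where "a i x = (\<integral>y. s i (x, y) * f \<theta> (x, y) \<partial>lborel) / p x" for i x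
  have cond: "g_cond f \<theta> i j =
      (\<integral>x. (\<integral>y. (s i (x, y) - a i x) * (s j (x, y) - a j x) * (f \<theta> (x, y) / p x) \<partial>lborel) * p x \<partial>lborel)" for i j
    unfolding g_cond_def fisher_def S(5) p_def[symmetric] a_def[symmetric] by (simp add: conditional_density_def p_def)
  note split = fisher_split[of "f \<theta>" s p a, OF S(1) fpos sm S(2)]
  show "g_aux f \<theta> i j = g_phys f \<theta> i j + g_cond f \<theta> i j"
    unfolding cond g_aux_def g_phys_def fisher_def S(3,4) p_def[symmetric] a_def[symmetric]
    by (rule split(1)) (simp_all add: p_def a_def marginal_density_def)
  show "0 \<le> (\<Sum>i\<in>UNIV. \<Sum>j\<in>UNIV. g_cond f \<theta> i j * \<xi> $ i * \<xi> $ j)"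
    unfolding cond by (rule split(2)) (simp_all add: p_def a_def marginal_density_def)
qed

section \<open>Regularity of Gaussian densities in the parameters\<close>

lemma pos_def_imp_det_nonzero:
  assumes "pos_def S"
  shows "det S \<noteq> 0"
proof -
  have "x = 0" if "S *v x = 0" for x
    using assms that by (auto simp: pos_def_def intro: ccontr)
  then show ?thesis
    by (metis invertible_det_nz invertible_left_inverse matrix_left_invertible_ker)
qed

lemma pos_def_imp_det_pos:
  fixes S :: "real^'k^'k"
  assumes S: "pos_def S"
  shows "0 < det S"
proof (rule ccontr)
  \<comment> \<open>Along the segment from the identity to \<open>S\<close> all matrices are positive definite, so \<open>det\<close> cannot change sign.\<close>
  define A where "A t = (1 - t) *\<^sub>R (mat 1 :: real^'k^'k) + t *\<^sub>R S" for t :: real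
  assume "\<not> 0 < det S"
  then have "det (A 1) \<le> 0" by (simp add: A_def)
  moreover have "0 \<le> det (A 0)" by (simp add: A_def)
  moreover have "continuous_on {0..1} (\<lambda>t. det (A t))"
    unfolding A_def det_def by (intro continuous_intros) 
  ultimately obtain t where t: "0 \<le> t" "t \<le> 1" "det (A t) = 0"
    using IVT2'[of "\<lambda>t. det (A t)" 1 0 0] by auto
  have "0 < x \<bullet> (A t *v x)" if x: "x \<noteq> 0" for x
  proof -
    have eq: "x \<bullet> (A t *v x) = (1 - t) * (x \<bullet> x) + t * (x \<bullet> (S *v x))"
      by (simp add: A_def matrix_vector_mult_add_rdistrib scaleR_matrix_vector_assoc[symmetric] inner_add_right)
    have "0 < x \<bullet> x" "0 < x \<bullet> (S *v x)" using S x by (simp_all add: pos_def_def)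
    then show ?thesis
      unfolding eq using t by (cases "t = 1") (auto intro: add_pos_nonneg)
  qed
  moreover have "transpose (A t) = A t"
    using S by (simp add: A_def pos_def_def transpose_def vec_eq_iff mat_def)
  ultimately have "pos_def (A t)" by (simp add: pos_def_def)
  with t show False using pos_def_imp_det_nonzero by blast
qed

lemma pos_def_matrix_inv:
  fixes S :: "real^'k^'k"
  assumes "pos_def S"
  shows "S ** matrix_inv S = mat 1" "matrix_inv S ** S = mat 1"
proof -
  have "invertible S"
    using pos_def_imp_det_nonzero[OF assms] by (simp add: invertible_det_nz)
  then show "S ** matrix_inv S = mat 1" "matrix_inv S ** S = mat 1"
    using someI_ex[of "\<lambda>B. S ** B = mat 1 \<and> B ** S = mat 1"] by (auto simp: invertible_def matrix_inv_def)
qed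

text \<open>Cramer's rule for the equation \<open>S\<close> v = e_j, whose solution is column j of
  the inverse. It turns the entries of the inverse into quotients of polynomials in the entries of
  \<open>S\<close>, from which differentiability can be read off.\<close>

lemma matrix_inv_nth_cramer:
  fixes S :: "real^'k^'k"
  assumes "pos_def S"
  shows "matrix_inv S $ i $ j = det (\<chi> a b. if b = i then axis j 1 $ a else S $ a $ b) / det S"
proof -
  have "S *v (matrix_inv S *v axis j 1) = axis j 1"
    by (simp add: matrix_vector_mul_assoc pos_def_matrix_inv[OF assms])
  then have "(matrix_inv S *v axis j 1) $ i = det (\<chi> a b. if b = i then axis j 1 $ a else S $ a $ b) / det S"
    by (simp add: cramer[OF pos_def_imp_det_nonzero[OF assms]])
  then show ?thesis
    by (simp add: matrix_vector_mult_basis column_def)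
qed

text \<open>The substitution w = \<open>S\<close> v turns the form of the inverse into that of
  \<open>S\<close>, so it is positive off the origin. Its minimum over the compact unit sphere is
  the constant, and homogeneity of degree two extends the bound to all vectors.\<close>

lemma matrix_inv_coercive:
  fixes S :: "real^'k^'k"
  assumes S: "pos_def S"
  obtains c where "0 < c" "\<And>w. c * (norm w)\<^sup>2 \<le> w \<bullet> (matrix_inv S *v w)"
proof -
  let ?q = "\<lambda>w. w \<bullet> (matrix_inv S *v w)"
  have pos: "0 < ?q w" if "w \<noteq> 0" for w
  proof -
    define v where "v = matrix_inv S *v w"
    have w: "w = S *v v"
      by (simp add: v_def matrix_vector_mul_assoc pos_def_matrix_inv[OF S])
    then have "v \<noteq> 0" using that by auto
    then have "0 < v \<bullet> (S *v v)" using S by (simp add: pos_def_def)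
    moreover have "?q w = v \<bullet> (S *v v)"
      unfolding v_def[symmetric] using w by (simp add: inner_commute)
    ultimately show ?thesis by simp
  qed
  have "\<exists>w\<in>sphere 0 1. \<forall>x\<in>sphere 0 1. ?q w \<le> ?q x"
    by (rule continuous_attains_inf) (auto intro!: continuous_intros)
  then obtain w0 :: "real^'k" where w0: "norm w0 = 1" "\<And>x. norm x = 1 \<Longrightarrow> ?q w0 \<le> ?q x"
    by auto
  show ?thesis
  proof
    show "0 < ?q w0" using w0 by (intro pos) auto
    fix w :: "real^'k"
    show "?q w0 * (norm w)\<^sup>2 \<le> ?q w"
    proof (cases "w = 0")
      case False
      then have "?q w0 \<le> ?q ((1 / norm w) *\<^sub>R w)" by (intro w0(2)) simp
      also have "\<dots> = ?q w / (norm w)\<^sup>2"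
        by (simp add: matrix_vector_mult_scaleR power2_eq_square)
      finally show ?thesis using False by (simp add: field_simps)
    qed simp
  qed
qed

section \<open>Differentiability and growth of Gaussian log densities along a line\<close>

lemma differentiable_prod:
  fixes f :: "'i \<Rightarrow> 'a::real_normed_vector \<Rightarrow> 'b::real_normed_field"
  assumes "\<And>i. i \<in> I \<Longrightarrow> f i differentiable (at x within T)"
  shows "(\<lambda>x. \<Prod>i\<in>I. f i x) differentiable (at x within T)"
  using assms by (induction I rule: infinite_finite_induct) simp_all

lemma differentiable_det:
  fixes A :: "'a::real_normed_vector \<Rightarrow> real^'k^'k"
  assumes "\<And>i j. (\<lambda>t. A t $ i $ j) differentiable (at x within T)"
  shows "(\<lambda>t. det (A t)) differentiable (at x within T)"
  unfolding det_def
  by (intro differentiable_sum ballI differentiable_mult differentiable_prod differentiable_const assms) simp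

lemma real_differentiable_cong_ev:
  fixes f g :: "real \<Rightarrow> real"
  assumes ev: "\<forall>\<^sub>F t in nhds x. f t = g t" and f: "f differentiable (at x)"
  shows "g differentiable (at x)"
proof -
  obtain D where "(f has_real_derivative D) (at x)"
    using f by (auto simp: real_differentiable_def)
  then have "(g has_real_derivative D) (at x)"
    by (rule DERIV_cong_ev[OF refl ev refl, THEN iffD1])
  then show ?thesis by (auto simp: real_differentiable_def)
qed

text \<open>The quotient in Cramer's rule is differentiable, and it agrees with the entry of the
  inverse wherever the matrix is positive definite, that is, on a neighbourhood of
  \<open>x\<close>.\<close>

lemma differentiable_matrix_inv:
  fixes A :: "real \<Rightarrow> real^'k^'k"
  assumes A: "\<And>i j. (\<lambda>t. A t $ i $ j) differentiable (at x)"
    and pd: "\<forall>\<^sub>F t in nhds x. pos_def (A t)"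
  shows "(\<lambda>t. matrix_inv (A t) $ i $ j) differentiable (at x)"
proof -
  have "(\<lambda>t. det (\<chi> a b. if b = i then axis j 1 $ a else A t $ a $ b) / det (A t)) differentiable (at x)"
  proof (intro differentiable_divide differentiable_det A)
    show "(\<lambda>t. (\<chi> a b. if b = i then axis j 1 $ a else A t $ a $ b) $ k $ l) differentiable at x" for k l
      using A by (cases "l = i") simp_all
    show "det (A x) \<noteq> 0"
      using eventually_nhds_x_imp_x[OF pd] by (rule pos_def_imp_det_nonzero)
  qed
  then show ?thesis
    by (rule real_differentiable_cong_ev[rotated])
      (use pd in \<open>eventually_elim, simp add: matrix_inv_nth_cramer\<close>)
qed

text \<open>The neighbourhood of 0 and the constant do not depend on \<open>z\<close>, a uniformity
  that differentiability at each \<open>z\<close> would not provide. The weight is the growth of a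
  polynomial of degree two, as in the increment hypothesis of
  \<open>gaussian_type_dominated\<close>.\<close>

definition quadratic_lipschitz :: "(real \<Rightarrow> 'a::real_normed_vector \<Rightarrow> real) \<Rightarrow> bool" where
  "quadratic_lipschitz u \<longleftrightarrow>
     (\<exists>C. \<forall>\<^sub>F t in nhds 0. \<forall>z. \<bar>u t z - u 0 z\<bar> \<le> C * \<bar>t\<bar> * (1 + (norm z)\<^sup>2))"

text \<open>Separated variables make uniformity in \<open>z\<close> immediate: the difference
  quotient of the coefficient is eventually below |D| + 1, and the factor \<phi> is bounded by the
  weight.\<close>

lemma quadratic_lipschitz_mult:
  assumes g: "g differentiable (at 0)" and \<phi>: "\<And>z. \<bar>\<phi> z\<bar> \<le> 1 + (norm z)\<^sup>2"
  shows "quadratic_lipschitz (\<lambda>t z. g t * \<phi> z)"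
proof -
  obtain D where D: "(g has_real_derivative D) (at 0)"
    using g by (auto simp: real_differentiable_def)
  have "((\<lambda>t. \<bar>(g t - g 0) / t\<bar>) \<longlongrightarrow> \<bar>D\<bar>) (at 0)"
    using D by (intro tendsto_rabs) (simp add: has_field_derivative_iff)
  then have "\<forall>\<^sub>F t in at 0. \<bar>(g t - g 0) / t\<bar> < \<bar>D\<bar> + 1"
    by (rule order_tendstoD) simp
  then have "\<forall>\<^sub>F t in at 0. \<bar>g t - g 0\<bar> \<le> (\<bar>D\<bar> + 1) * \<bar>t\<bar>"
  proof (rule eventually_mono)
    fix t assume "\<bar>(g t - g 0) / t\<bar> < \<bar>D\<bar> + 1"
    then show "\<bar>g t - g 0\<bar> \<le> (\<bar>D\<bar> + 1) * \<bar>t\<bar>"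
      by (cases "t = 0") (simp_all add: abs_divide pos_divide_less_eq)
  qed
  then have "\<forall>\<^sub>F t in nhds 0. \<bar>g t - g 0\<bar> \<le> (\<bar>D\<bar> + 1) * \<bar>t\<bar>"
    by (simp add: eventually_nhds_conv_at)
  then have "\<forall>\<^sub>F t in nhds 0. \<forall>z. \<bar>g t * \<phi> z - g 0 * \<phi> z\<bar> \<le> (\<bar>D\<bar> + 1) * \<bar>t\<bar> * (1 + (norm z)\<^sup>2)"
  proof (rule eventually_mono, intro allI)
    fix t z assume t: "\<bar>g t - g 0\<bar> \<le> (\<bar>D\<bar> + 1) * \<bar>t\<bar>"
    have "\<bar>g t * \<phi> z - g 0 * \<phi> z\<bar> = \<bar>g t - g 0\<bar> * \<bar>\<phi> z\<bar>"
      by (simp add: abs_mult[symmetric] left_diff_distrib)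
    also have "\<dots> \<le> (\<bar>D\<bar> + 1) * \<bar>t\<bar> * (1 + (norm z)\<^sup>2)"
      using t \<phi>[of z] by (intro mult_mono) simp_all
    finally show "\<bar>g t * \<phi> z - g 0 * \<phi> z\<bar> \<le> (\<bar>D\<bar> + 1) * \<bar>t\<bar> * (1 + (norm z)\<^sup>2)" .
  qed
  then show ?thesis unfolding quadratic_lipschitz_def by blast
qed

lemma quadratic_lipschitz_add:
  assumes "quadratic_lipschitz u" "quadratic_lipschitz v"
  shows "quadratic_lipschitz (\<lambda>t z. u t z + v t z)"
proof -
  obtain C D where C: "\<forall>\<^sub>F t in nhds 0. \<forall>z. \<bar>u t z - u 0 z\<bar> \<le> C * \<bar>t\<bar> * (1 + (norm z)\<^sup>2)"
    and D: "\<forall>\<^sub>F t in nhds 0. \<forall>z. \<bar>v t z - v 0 z\<bar> \<le> D * \<bar>t\<bar> * (1 + (norm z)\<^sup>2)"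
    using assms by (auto simp: quadratic_lipschitz_def)
  have "\<forall>\<^sub>F t in nhds 0. \<forall>z. \<bar>u t z + v t z - (u 0 z + v 0 z)\<bar> \<le> (C + D) * \<bar>t\<bar> * (1 + (norm z)\<^sup>2)"
    using C D
  proof eventually_elim
    case (elim t)
    show ?case
    proof
      fix z
      have "\<bar>u t z - u 0 z\<bar> \<le> C * \<bar>t\<bar> * (1 + (norm z)\<^sup>2)" "\<bar>v t z - v 0 z\<bar> \<le> D * \<bar>t\<bar> * (1 + (norm z)\<^sup>2)"
        using elim by blast+
      moreover have "(C + D) * \<bar>t\<bar> * (1 + (norm z)\<^sup>2) = C * \<bar>t\<bar> * (1 + (norm z)\<^sup>2) + D * \<bar>t\<bar> * (1 + (norm z)\<^sup>2)"
        by (simp only: distrib_right)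
      ultimately show "\<bar>u t z + v t z - (u 0 z + v 0 z)\<bar> \<le> (C + D) * \<bar>t\<bar> * (1 + (norm z)\<^sup>2)"
        by linarith
    qed
  qed
  then show ?thesis unfolding quadratic_lipschitz_def by blast
qed

lemma quadratic_lipschitz_sum:
  assumes "finite I" "\<And>i. i \<in> I \<Longrightarrow> quadratic_lipschitz (u i)"
  shows "quadratic_lipschitz (\<lambda>t z. \<Sum>i\<in>I. u i t z)"
  using assms
proof (induction I rule: finite_induct)
  case empty
  show ?case by (auto simp: quadratic_lipschitz_def intro!: exI[of _ 0])
next
  case (insert i I)
  then show ?case by (simp add: quadratic_lipschitz_add)
qed

lemma quadratic_lipschitz_cong_ev:
  assumes "quadratic_lipschitz u" and ev: "\<forall>\<^sub>F t in nhds 0. \<forall>z. u t z = v t z"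
  shows "quadratic_lipschitz v"
proof -
  obtain C where C: "\<forall>\<^sub>F t in nhds 0. \<forall>z. \<bar>u t z - u 0 z\<bar> \<le> C * \<bar>t\<bar> * (1 + (norm z)\<^sup>2)"
    using assms by (auto simp: quadratic_lipschitz_def)
  have uv: "\<forall>z. u 0 z = v 0 z" using eventually_nhds_x_imp_x[OF ev] .
  from C ev have "\<forall>\<^sub>F t in nhds 0. \<forall>z. \<bar>v t z - v 0 z\<bar> \<le> C * \<bar>t\<bar> * (1 + (norm z)\<^sup>2)"
    by eventually_elim (simp add: uv)
  then show ?thesis unfolding quadratic_lipschitz_def by blast
qed

text \<open>The second identity serves the upper bound, the third the regularity in the parameter:
  it is a sum of coefficients depending on \<open>m\<close> and \<open>S\<close> times monomials in
  \<open>z\<close>. The trailing factors \<open>* 1\<close> are the constant monomial, so that every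
  term has the product shape of \<open>quadratic_lipschitz_mult\<close>.\<close>

lemma ln_gaussian_density:
  fixes m :: "real^'k" and S :: "real^'k^'k"
  assumes S: "pos_def S"
  defines "P \<equiv> matrix_inv S"
  shows "0 < gaussian_density m S z"
    and "ln (gaussian_density m S z) =
      - ((z - m) \<bullet> (P *v (z - m))) / 2 - ln ((2 * pi) ^ CARD('k) * det S) / 2" (is ?ln)
    and "ln (gaussian_density m S z) =
      (\<Sum>a\<in>UNIV. \<Sum>b\<in>UNIV. (- (P $ a $ b) / 2) * (z $ a * z $ b) + (P $ a $ b * m $ b / 2) * z $ a
        + (P $ a $ b * m $ a / 2) * z $ b + (- (P $ a $ b * m $ a * m $ b) / 2) * 1)
      + (- ln ((2 * pi) ^ CARD('k) * det S) / 2) * 1" (is "_ = ?rhs")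
proof -
  have d: "0 < (2 * pi) ^ CARD('k) * det S"
    using pos_def_imp_det_pos[OF S] by simp
  then show "0 < gaussian_density m S z" by (simp add: gaussian_density_def)
  have "ln (exp q / sqrt K) = q - ln K / 2" if "0 < K" for q K :: real
    using that by (simp add: ln_div ln_sqrt)
  then show l: ?ln
    unfolding gaussian_density_def P_def using d by blast
  have "(z - m) \<bullet> (P *v (z - m)) = (\<Sum>a\<in>UNIV. \<Sum>b\<in>UNIV. P $ a $ b * (z $ a - m $ a) * (z $ b - m $ b))"
    by (simp add: inner_vec_def matrix_vector_mult_def sum_distrib_left mult_ac)
  then have "- ((z - m) \<bullet> (P *v (z - m))) / 2 =
      (\<Sum>a\<in>UNIV. \<Sum>b\<in>UNIV. - (P $ a $ b * (z $ a - m $ a) * (z $ b - m $ b)) / 2)"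
    by (simp add: sum_negf sum_divide_distrib)
  also have "\<dots> = (\<Sum>a\<in>UNIV. \<Sum>b\<in>UNIV. (- (P $ a $ b) / 2) * (z $ a * z $ b) + (P $ a $ b * m $ b / 2) * z $ a
        + (P $ a $ b * m $ a / 2) * z $ b + (- (P $ a $ b * m $ a * m $ b) / 2) * 1)"
    by (intro sum.cong refl) (simp add: field_simps)
  finally show "ln (gaussian_density m S z) = ?rhs"
    unfolding l by simp
qed

lemma ln_gaussian_density_family:
  fixes m :: "real \<Rightarrow> real^'k" and S :: "real \<Rightarrow> real^'k^'k"
  assumes m: "\<And>a. (\<lambda>t. m t $ a) differentiable (at 0)"
    and S: "\<And>a b. (\<lambda>t. S t $ a $ b) differentiable (at 0)"
    and pd: "\<forall>\<^sub>F t in nhds 0. pos_def (S t)"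
  shows "quadratic_lipschitz (\<lambda>t z. ln (gaussian_density (m t) (S t) z))" (is ?q)
    and "(\<lambda>t. ln (gaussian_density (m t) (S t) z)) differentiable (at 0)" (is ?d)
proof -
  have pd0: "pos_def (S 0)" using eventually_nhds_x_imp_x[OF pd] .
  have P: "(\<lambda>t. matrix_inv (S t) $ a $ b) differentiable (at 0)" for a b
    by (rule differentiable_matrix_inv[OF S pd])
  have "(\<lambda>t. (2 * pi) ^ CARD('k) * det (S t)) differentiable (at 0)"
    by (intro differentiable_mult differentiable_const differentiable_det S)
  then obtain D where D: "((\<lambda>t. (2 * pi) ^ CARD('k) * det (S t)) has_real_derivative D) (at 0)"
    by (auto simp: real_differentiable_def)
  have "((\<lambda>t. ln ((2 * pi) ^ CARD('k) * det (S t))) has_real_derivative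
      inverse ((2 * pi) ^ CARD('k) * det (S 0)) * D) (at 0)"
    using pos_def_imp_det_pos[OF pd0] by (intro DERIV_chain2[OF DERIV_ln D]) simp
  then have L: "(\<lambda>t. ln ((2 * pi) ^ CARD('k) * det (S t))) differentiable (at 0)"
    by (auto simp: real_differentiable_def)
  let ?F = "\<lambda>t z. (\<Sum>a\<in>UNIV. \<Sum>b\<in>UNIV. (- (matrix_inv (S t) $ a $ b) / 2) * (z $ a * z $ b)
        + (matrix_inv (S t) $ a $ b * m t $ b / 2) * z $ a
        + (matrix_inv (S t) $ a $ b * m t $ a / 2) * z $ b
        + (- (matrix_inv (S t) $ a $ b * m t $ a * m t $ b) / 2) * 1)
      + (- ln ((2 * pi) ^ CARD('k) * det (S t)) / 2) * 1"
  have ev: "\<forall>\<^sub>F t in nhds 0. \<forall>z. ?F t z = ln (gaussian_density (m t) (S t) z)"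
    using pd by eventually_elim (simp only: ln_gaussian_density(3) simp_thms)
  have c2: "\<bar>z $ a * z $ b\<bar> \<le> 1 + (norm z)\<^sup>2" for z :: "real^'k" and a b
  proof -
    have "\<bar>z $ a\<bar> * \<bar>z $ b\<bar> \<le> norm z * norm z"
      by (intro mult_mono component_le_norm_cart) simp_all
    then show ?thesis by (simp add: abs_mult power2_eq_square)
  qed
  have c1: "\<bar>z $ a\<bar> \<le> 1 + (norm z)\<^sup>2" for z :: "real^'k" and a
  proof -
    \<comment> \<open>Adding \<open>norm z\<close> to the square turns its middle term
      \<open>- 2 * norm z\<close> into \<open>- norm z\<close>, which is the inequality
      wanted.\<close>
    have "0 \<le> (norm z - 1)\<^sup>2 + norm z" by simp
    then have "norm z \<le> 1 + (norm z)\<^sup>2" by (simp add: power2_diff)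
    then show ?thesis using component_le_norm_cart[of z a] by linarith
  qed
  have "quadratic_lipschitz ?F"
    by (intro quadratic_lipschitz_add quadratic_lipschitz_sum quadratic_lipschitz_mult
        differentiable_divide differentiable_minus differentiable_mult differentiable_const P m L c1 c2) simp_all
  then show ?q using ev by (rule quadratic_lipschitz_cong_ev)
  have "(\<lambda>t. ?F t z) differentiable (at 0)"
    by (intro differentiable_add differentiable_sum ballI
        differentiable_divide differentiable_minus differentiable_mult differentiable_const P m L) simp_all
  moreover have "\<forall>\<^sub>F t in nhds 0. ?F t z = ln (gaussian_density (m t) (S t) z)"
    using ev by (rule eventually_mono) blast
  ultimately show ?d by (rule real_differentiable_cong_ev[rotated])
qed

lemma ln_gaussian_density_upper:
  fixes m :: "real^'k" and S :: "real^'k^'k"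
  assumes S: "pos_def S"
  obtains B c where "0 < c" "\<And>z. ln (gaussian_density m S z) \<le> B - c * (norm z)\<^sup>2"
proof -
  obtain c where c: "0 < c" "\<And>w. c * (norm w)\<^sup>2 \<le> w \<bullet> (matrix_inv S *v w)"
    using matrix_inv_coercive[OF S] by blast
  show ?thesis
  proof
    \<comment> \<open>One factor 1/2 comes from the Gaussian exponent, the other from |z|^2 \<le> 2
      |z - m|^2 + 2 |m|^2; the mean contributes \<open>c * (norm m)\<^sup>2 / 2\<close> to the
      constant.\<close>
    show "0 < c / 4" using c by simp
    fix z
    have "(norm z)\<^sup>2 \<le> (norm (z - m) + norm m)\<^sup>2"
      using norm_triangle_ineq[of "z - m" m] by (intro power_mono) simp_all
    also have "\<dots> \<le> 2 * (norm (z - m))\<^sup>2 + 2 * (norm m)\<^sup>2"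
      using zero_le_power2[of "norm (z - m) - norm m"] unfolding power2_diff power2_sum by linarith
    finally have "c * (norm z)\<^sup>2 \<le> c * (2 * (norm (z - m))\<^sup>2 + 2 * (norm m)\<^sup>2)"
      using c(1) by (intro mult_left_mono) simp_all
    then have "c * (norm z)\<^sup>2 \<le> 2 * (c * (norm (z - m))\<^sup>2) + 2 * (c * (norm m)\<^sup>2)"
      by (simp add: algebra_simps)
    then show "ln (gaussian_density m S z) \<le>
        (c * (norm m)\<^sup>2 / 2 - ln ((2 * pi) ^ CARD('k) * det S) / 2) - c / 4 * (norm z)\<^sup>2"
      unfolding ln_gaussian_density(2)[OF S] using c(2)[of "z - m"] by simp
  qed
qed

section \<open>Continuous densities, product coordinates and measurability of scores\<close>

lemma continuous_gaussian_density:
  fixes S :: "real^'k^'k"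
  assumes "pos_def S"
  shows "continuous_on UNIV (gaussian_density m S)"
proof -
  have "sqrt ((2 * pi) ^ CARD('k) * det S) \<noteq> 0"
    using pos_def_imp_det_pos[OF assms] by simp
  then show ?thesis
    unfolding gaussian_density_def
    by (intro continuous_on_divide continuous_on_const continuous_on_exp continuous_on_minus ballI
        continuous_on_inner continuous_on_diff continuous_on_id
        bounded_linear.continuous_on[OF matrix_vector_mul_bounded_linear]) simp_all
qed

text \<open>Here \<open>join\<close> is the one of \<open>Defs\<close>; the Giry monad operation of the same name is shadowed because
  \<open>Defs\<close> is imported last.\<close>

lemma norm_join: "norm (join z) = norm z"
proof -
  have "join z \<bullet> join z = z \<bullet> z"
    unfolding inner_vec_def UNIV_Plus_UNIV[symmetric]
    by (subst sum.Plus) (simp_all add: join_def inner_prod_def inner_vec_def)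
  then show ?thesis by (simp add: norm_eq_sqrt_inner)
qed

lemma continuous_join: "continuous_on UNIV join"
  unfolding join_def
proof (rule continuous_on_vec_lambda)
  fix i :: "'a + 'b"
  show "continuous_on UNIV (\<lambda>z. case i of Inl a \<Rightarrow> fst z $ a | Inr b \<Rightarrow> snd z $ b)"
    by (cases i) (auto intro!: continuous_intros)
qed

text \<open>Two densities of one measure agree almost everywhere. If both are continuous, the set
  where they differ is open and null, hence empty. Equality at every point matters because scores
  are derivatives in the parameter at a fixed point \<open>z\<close>.\<close>

lemma continuous_density_unique:
  fixes f g :: "'a::euclidean_space \<Rightarrow> real"
  assumes "continuous_density \<nu> f" "continuous_density \<nu> g"
  shows "f = g"
proof -
  have cont: "continuous_on UNIV f" "continuous_on UNIV g" and nonneg: "\<And>z. 0 \<le> f z" "\<And>z. 0 \<le> g z"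
    and eq: "density lborel (\<lambda>z. ennreal (f z)) = density lborel (\<lambda>z. ennreal (g z))"
    using assms by (auto simp: continuous_density_def)
  have [measurable]: "f \<in> borel_measurable borel" "g \<in> borel_measurable borel"
    using cont by (auto intro: borel_measurable_continuous_onI)
  have "AE z in lborel. ennreal (f z) = ennreal (g z)"
    using eq by (subst (asm) sigma_finite_measure.density_unique_iff[OF sigma_finite_lborel]) simp_all
  then have AE: "AE z in lborel. z \<notin> {z. f z \<noteq> g z}"
    by eventually_elim (simp add: nonneg)
  have "open {z. f z \<noteq> g z}" by (intro open_Collect_neq cont)
  then have "{z. f z \<noteq> g z} \<in> null_sets lborel"
    using AE by (subst (asm) AE_iff_null_sets[symmetric]) auto
  then have "negligible {z. f z \<noteq> g z}"
    by (simp add: negligible_iff_null_sets null_sets_completionI)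
  then have "{z. f z \<noteq> g z} = {}"
    using \<open>open {z. f z \<noteq> g z}\<close> open_not_negligible by blast
  then show ?thesis by auto
qed

text \<open>The derivative is the pointwise limit of difference quotients along one fixed sequence,
  and each quotient is measurable.\<close>

lemma borel_measurable_deriv_parameter:
  fixes u :: "real \<Rightarrow> 'a \<Rightarrow> real"
  assumes meas: "\<forall>\<^sub>F t in nhds 0. u t \<in> borel_measurable M"
    and D: "\<And>z. ((\<lambda>t. u t z) has_real_derivative s z) (at 0)"
  shows "s \<in> borel_measurable M"
proof -
  obtain \<epsilon> where \<epsilon>: "0 < \<epsilon>" "\<And>t. \<bar>t\<bar> < \<epsilon> \<Longrightarrow> u t \<in> borel_measurable M"
    using meas by (auto simp: eventually_nhds_metric dist_real_def)
  \<comment> \<open>The shift by 2 keeps the first term strictly below \<epsilon>.\<close>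
  define X where "X n = \<epsilon> / real (n + 2)" for n
  have X: "\<bar>X n\<bar> < \<epsilon>" "X n \<noteq> 0" for n
  proof -
    have "\<epsilon> * 1 < \<epsilon> * real (n + 2)" using \<epsilon>(1) by (intro mult_strict_left_mono) simp_all
    then show "\<bar>X n\<bar> < \<epsilon>" "X n \<noteq> 0" using \<epsilon>(1) by (simp_all add: X_def pos_divide_less_eq)
  qed
  have "X \<longlonglongrightarrow> 0"
    unfolding X_def by (rule LIMSEQ_ignore_initial_segment) (rule lim_const_over_n)
  then have lim: "(\<lambda>n. (u (X n) z - u 0 z) / X n) \<longlonglongrightarrow> s z" for z
    using D[of z] X(2) unfolding has_field_derivative_iff tendsto_at_iff_sequentially
    by (auto simp: comp_def)
  have "(\<lambda>z. (u (X n) z - u 0 z) / X n) \<in> borel_measurable M" for n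
    using \<epsilon>(2)[OF X(1)] \<epsilon>(2)[of 0] \<epsilon>(1) by simp
  then show ?thesis
    by (rule borel_measurable_LIMSEQ_metric) (rule lim)
qed

lemma differentiable_vec_nth:
  assumes "h differentiable F"
  shows "(\<lambda>t. h t $ a) differentiable F"
  using assms bounded_linear.has_derivative[OF bounded_linear_vec_nth]
  unfolding differentiable_def by blast

lemma quadratic_lipschitz_join:
  assumes "quadratic_lipschitz u"
  shows "quadratic_lipschitz (\<lambda>t z. u t (join z))"
proof -
  obtain C where "\<forall>\<^sub>F t in nhds 0. \<forall>w. \<bar>u t w - u 0 w\<bar> \<le> C * \<bar>t\<bar> * (1 + (norm w)\<^sup>2)"
    using assms by (auto simp: quadratic_lipschitz_def)
  then have "\<forall>\<^sub>F t in nhds 0. \<forall>z. \<bar>u t (join z) - u 0 (join z)\<bar> \<le> C * \<bar>t\<bar> * (1 + (norm z)\<^sup>2)"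
    by (rule eventually_mono) (metis norm_join)
  then show ?thesis unfolding quadratic_lipschitz_def by blast
qed

theorem proposition7:
  fixes M :: "'m topology"
    and A :: "'m chart set"
    and G :: "'m chart \<Rightarrow> real^3 \<Rightarrow> real^3^3"
    and K :: "'b::euclidean_space set set"
    and h :: "'b \<Rightarrow> 'm"
    and ep :: "'p::finite \<Rightarrow> 'b list \<Rightarrow> real"
    and eg :: "'g::finite \<Rightarrow> 'b list \<Rightarrow> real"
    and \<Theta> :: "(real^'n::finite) set"
    and \<mu> :: "real^'n \<Rightarrow> ('b list \<Rightarrow> real) measure"
    and m :: "real^'n \<Rightarrow> real^('p + 'g)"
    and S :: "real^'n \<Rightarrow> real^('p + 'g)^('p + 'g)"
    and f :: "real^'n \<Rightarrow> (real^'p) \<times> (real^'g) \<Rightarrow> real"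
  assumes "closed_oriented_riemannian_3manifold M A G"
    and "smooth_triangulation M A K h"
    and "whitney_orthonormal_basis A G K h (V_p A G K h) ep"
    and "whitney_orthonormal_basis A G K h (V_g K) eg"
    and "open \<Theta>"
    and "smooth_on \<Theta> m"
    and "smooth_on \<Theta> S"
    and "\<And>\<theta>. \<theta> \<in> \<Theta> \<Longrightarrow> sets (\<mu> \<theta>) = sets (cochain_space K 1)"
    and "\<And>\<theta>. \<theta> \<in> \<Theta> \<Longrightarrow>
           nondegenerate_gaussian (distr (\<mu> \<theta>) borel (whitney_coords A G K h ep eg)) (m \<theta>) (S \<theta>)"
    and "\<And>\<theta>. \<theta> \<in> \<Theta> \<Longrightarrow>
           continuous_density (distr (\<mu> \<theta>) borel (whitney_coords A G K h ep eg)) (f \<theta>)"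
    and "\<theta> \<in> \<Theta>"
  shows "(\<forall>i j. g_aux f \<theta> i j = g_phys f \<theta> i j + g_cond f \<theta> i j) \<and>
         (\<forall>\<xi> :: real^'n. 0 \<le> (\<Sum>i\<in>UNIV. \<Sum>j\<in>UNIV. (g_aux f \<theta> i j - g_phys f \<theta> i j) * \<xi> $ i * \<xi> $ j))"
proof -
  \<comment> \<open>The law in Whitney coordinates has \<open>f \<theta>'\<close> as a continuous
    density and the explicit Gaussian density as another, so the two functions coincide
    pointwise.\<close>
  have gauss: "pos_def (S \<theta>')" "f \<theta>' = (\<lambda>z. gaussian_density (m \<theta>') (S \<theta>') (join z))"
    if th: "\<theta>' \<in> \<Theta>" for \<theta>'
  proof -
    show pd: "pos_def (S \<theta>')"
      using assms(9)[OF th] by (simp add: nondegenerate_gaussian_def)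
    have "continuous_on UNIV (\<lambda>z. gaussian_density (m \<theta>') (S \<theta>') (join z))"
      by (rule continuous_on_compose2[OF continuous_gaussian_density[OF pd] continuous_join]) simp
    then have "continuous_density (distr (\<mu> \<theta>') borel (whitney_coords A G K h ep eg))
        (\<lambda>z. gaussian_density (m \<theta>') (S \<theta>') (join z))"
      using assms(9)[OF th] less_imp_le[OF ln_gaussian_density(1)[OF pd]]
      unfolding continuous_density_def nondegenerate_gaussian_def by blast
    then show "f \<theta>' = (\<lambda>z. gaussian_density (m \<theta>') (S \<theta>') (join z))"
      by (rule continuous_density_unique[OF assms(10)[OF th]])
  qed
  let ?\<theta> = "\<lambda>i t. \<theta> + t *\<^sub>R (axis i 1 :: real^'n)"
  have line: "(?\<theta> i \<longlongrightarrow> \<theta>) (nhds 0)" for i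
  proof -
    have "(?\<theta> i \<longlongrightarrow> ?\<theta> i 0) (nhds 0)"
      by (intro tendsto_add tendsto_scaleR tendsto_const filterlim_ident)
    then show ?thesis by simp
  qed
  \<comment> \<open>As \<Theta> is open, short coordinate segments through \<theta> stay in it, so
    everything known on \<Theta> holds for all small \<open>t\<close>.\<close>
  have near: "\<forall>\<^sub>F t in nhds 0. ?\<theta> i t \<in> \<Theta>" for i
    using topological_tendstoD[OF line assms(5,11)] .
  have diff: "(\<lambda>t. g (?\<theta> i t)) differentiable (at 0)"
    if "smooth_on \<Theta> g" for i and g :: "real^'n \<Rightarrow> 'v::real_normed_vector"
  proof -
    \<comment> \<open>Level one of the smoothness hierarchy contains Frechet differentiability at
      \<theta>; the chain rule restricts it to the coordinate line.\<close>
    have "Ck_on (Suc 0) \<Theta> g" using that unfolding smooth_on_def by blast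
    then have "g differentiable (at \<theta>)"
      using assms(5,11) by (simp add: differentiable_on_eq_differentiable_at)
    then have "g differentiable (at (?\<theta> i 0))" by simp
    moreover have "?\<theta> i differentiable (at 0)" by simp
    ultimately show ?thesis
      using differentiable_chain_at[of "?\<theta> i" 0 g] by (simp add: comp_def)
  qed
  have m: "(\<lambda>t. m (?\<theta> i t) $ a) differentiable (at 0)" for i a
    by (rule differentiable_vec_nth[OF diff[OF assms(6)]])
  have S: "(\<lambda>t. S (?\<theta> i t) $ a $ b) differentiable (at 0)" for i a b
    by (rule differentiable_vec_nth[OF differentiable_vec_nth[OF diff[OF assms(7)]]])
  have pd: "\<forall>\<^sub>F t in nhds 0. pos_def (S (?\<theta> i t))" for i
    using near[of i] by (rule eventually_mono) (rule gauss)
  note L = ln_gaussian_density_family[OF m S pd]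
  have feq: "\<forall>\<^sub>F t in nhds 0. \<forall>z. ln (gaussian_density (m (?\<theta> i t)) (S (?\<theta> i t)) (join z)) = ln (f (?\<theta> i t) z)" for i
    using near[of i] by (rule eventually_mono) (simp add: gauss)
  have meas: "\<forall>\<^sub>F t in nhds 0. f (?\<theta> i t) \<in> borel_measurable borel" for i
    using near[of i]
  proof (rule eventually_mono)
    fix t assume "?\<theta> i t \<in> \<Theta>"
    then have "continuous_on UNIV (f (?\<theta> i t))"
      using assms(10) unfolding continuous_density_def by blast
    then show "f (?\<theta> i t) \<in> borel_measurable borel"
      by (rule borel_measurable_continuous_onI)
  qed
  have pos: "\<forall>\<^sub>F t in nhds 0. \<forall>z. 0 < f (?\<theta> i t) z" for i
    using near[of i] by (rule eventually_mono) (simp add: gauss ln_gaussian_density(1))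
  have ql: "quadratic_lipschitz (\<lambda>t z. ln (f (?\<theta> i t) z))" for i
    by (rule quadratic_lipschitz_cong_ev[OF quadratic_lipschitz_join[OF L(1)] feq])
  have lip: "\<exists>C. \<forall>\<^sub>F t in nhds 0. \<forall>z.
      \<bar>ln (f (?\<theta> i t) z) - ln (f \<theta> z)\<bar> \<le> C * \<bar>t\<bar> * (1 + (norm z)\<^sup>2)" for i
    using ql[of i] by (simp add: quadratic_lipschitz_def)
  define s where "s i z = deriv (\<lambda>t. ln (f (?\<theta> i t) z)) 0" for i z
  have s: "((\<lambda>t. ln (f (?\<theta> i t) z)) has_real_derivative s i z) (at 0)" for i z
  proof -
    have "\<forall>\<^sub>F t in nhds 0. ln (gaussian_density (m (?\<theta> i t)) (S (?\<theta> i t)) (join z)) = ln (f (?\<theta> i t) z)"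
      using feq[of i] by (rule eventually_mono) blast
    then have "(\<lambda>t. ln (f (?\<theta> i t) z)) differentiable (at 0)"
      by (rule real_differentiable_cong_ev[OF _ L(2)])
    then show ?thesis
      unfolding s_def using DERIV_imp_deriv by (fastforce simp: real_differentiable_def)
  qed
  have sm: "s i \<in> borel_measurable borel" for i
  proof (rule borel_measurable_deriv_parameter[OF _ s])
    show "\<forall>\<^sub>F t in nhds 0. (\<lambda>z. ln (f (?\<theta> i t) z)) \<in> borel_measurable borel"
      using meas[of i] by (rule eventually_mono) simp
  qed
  obtain B c where c: "0 < c" and B: "\<And>w. ln (gaussian_density (m \<theta>) (S \<theta>) w) \<le> B - c * (norm w)\<^sup>2"
    using ln_gaussian_density_upper[OF gauss(1)[OF assms(11)]] by blast
  \<comment> \<open>\<open>join\<close> preserves norms, so the bound carries over from the joined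
    vector to the pair with the same constants.\<close>
  have dec: "ln (f \<theta> z) \<le> B - c * (norm z)\<^sup>2" for z
    using B[of "join z"] by (simp add: gauss(2)[OF assms(11)] norm_join)
  note dcmp = fisher_decomposition[where f = f and \<theta> = \<theta> and s = s and c = c and B = B, OF meas pos lip s c dec sm]
  show ?thesis
  proof (intro conjI allI)
    show "g_aux f \<theta> i j = g_phys f \<theta> i j + g_cond f \<theta> i j" for i j
      by (rule dcmp(1))
    show "0 \<le> (\<Sum>i\<in>UNIV. \<Sum>j\<in>UNIV. (g_aux f \<theta> i j - g_phys f \<theta> i j) * \<xi> $ i * \<xi> $ j)" for \<xi> :: "real^'n"
      using dcmp(2)[of \<xi>] by (simp add: dcmp(1))
  qed
qed

end
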